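(* Let $l$ be a prime with $l\equiv7\pmod8$ and $n=l+1$. Index coordinates of $\mathbf{R}^n$ by $\infty,0,1,\ldots,l-1$, with unit vectors $\mathbf{e}_\infty,\mathbf{e}_0,\ldots,\mathbf{e}_{l-1}$. Let $W$ be the Paley matrix: $W_{\infty\infty}=0$, $W_{\infty j}=1$, $W_{j\infty}=-1$ and $W_{ij}=\left(\frac{j-i}{l}\right)$ (Legendre symbol, $0$ if $i=j$) for $i,j\in\{0,\ldots,l-1\}$. Let $\mathcal{O}=\mathbf{Z}[\frac{1+\sqrt{-l}}{2}]$ act on $\mathbf{R}^n$ via $(r+s\sqrt{-l})\mathbf{v}=\mathbf{v}(rI+sW)$, let $L_0=\{\mathbf{a}\in\mathbf{Z}^n:\sum a_\mu\equiv0\pmod2\}$, $L_+=L_0\cup(\tfrac12\mathbf{e}_\infty(I+W)+L_0)$, and $\mathcal{Q}=\langle2,\tfrac12(1-\sqrt{-l})\rangle$. For an integer $r\ge1$ (so that $\mathcal{Q}^rL_+\subseteq\mathbf{Z}^n$), let $\mathcal{C}_r\subseteq(\mathbf{Z}/2^r\mathbf{Z})^n$ be the reduction modulo $2^r$ of $\mathcal{Q}^rL_+$, and let $\mathcal{C}_r'\subseteq(\mathbf{Z}/2^r\mathbf{Z})^l$ be the image of $\mathcal{C}_r$ under deleting the $\infty$-coordinate. Then $\mathcal{C}_r'$ is the lifted quadratic residue code over $\mathbf{Z}/2^r\mathbf{Z}$ with generator polynomial $f_+^{(r)}(X)$.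
   Context: $\mathcal{Q}^rL_+$ is the subgroup generated by $\alpha\mathbf{v}$, $\alpha\in\mathcal{Q}^r$, $\mathbf{v}\in L_+$. Quadratic residue codes: let $\zeta$ be a primitive $l$-th root of unity in a finite extension of $\mathbf{F}_2$, $f_+(X)=\prod_{(j/l)=1}(X-\zeta^j)$, $f_-(X)=\prod_{(j/l)=-1}(X-\zeta^j)$; these lie in $\mathbf{F}_2[X]$ and $X^l-1=(X-1)f_+f_-$, and $\zeta$ is chosen so that the coefficient of $X^{(l-3)/2}$ in $f_+$ is $0$ (and in $f_-$ is $1$). By Hensel's lemma there are unique $f_\pm^{(r)}\in(\mathbf{Z}/2^r\mathbf{Z})[X]$ with $X^l-1=(X-1)f_+^{(r)}f_-^{(r)}$ and $f_\pm^{(r)}\equiv f_\pm\pmod2$. Identifying $(c_0,\ldots,c_{l-1})$ with $\sum c_jX^j\in(\mathbf{Z}/2^r\mathbf{Z})[X]/(X^l-1)$, the lifted quadratic residue code with generator $f_+^{(r)}$ is the ideal generated by $f_+^{(r)}$. *)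

theory Defs
  imports
    "HOL-Analysis.Analysis"
    "HOL-Number_Theory.Number_Theory"
    "HOL-Computational_Algebra.Group_Closure"
    "Berlekamp_Zassenhaus.Finite_Field"
begin

text \<open>
  Throughout, \<open>l = CARD('l)\<close>. The coordinates are indexed by \<open>'l mod_ring option\<close>:
  \<open>None\<close> is the coordinate \<open>\<infinity>\<close>, and \<open>Some j\<close> is the coordinate
  \<open>to_int_mod_ring j \<in> {0..<l}\<close>.
\<close>

type_synonym 'l coord = "'l mod_ring option"


section \<open>The Paley matrix and the quadratic order acting on it\<close>

definition paley :: "real ^ ('l::finite coord) ^ ('l coord)" where
  "paley = (\<chi> \<mu> \<nu>. case \<mu> of
      None \<Rightarrow> (case \<nu> of None \<Rightarrow> 0 | Some j \<Rightarrow> 1)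
    | Some i \<Rightarrow> (case \<nu> of None \<Rightarrow> - 1
        | Some j \<Rightarrow> of_int (Legendre (to_int_mod_ring j - to_int_mod_ring i) (int CARD('l)))))"

definition sqrt_minus :: "nat \<Rightarrow> complex" where
  "sqrt_minus l = \<i> * complex_of_real (sqrt (real l))"

definition quad_order :: "nat \<Rightarrow> complex set" where
  "quad_order l = range (\<lambda>p :: int poly. poly (map_poly of_int p) ((1 + sqrt_minus l) / 2))"

text \<open>
  A complex number \<open>z = r + s * sqrt_minus l\<close> with \<open>r\<close>, \<open>s\<close> real has
  \<open>r = Re z\<close> and \<open>s = Im z / sqrt l\<close>. Vectors are row vectors.
\<close>

definition act :: "complex \<Rightarrow> real ^ ('l::finite coord) \<Rightarrow> real ^ ('l coord)" where
  "act z v = v v* (Re z *\<^sub>R mat 1 + (Im z / sqrt (real CARD('l))) *\<^sub>R paley)"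

definition ideal_generated :: "nat \<Rightarrow> complex set \<Rightarrow> complex set" where
  "ideal_generated l S = group_closure {\<alpha> * s | \<alpha> s. \<alpha> \<in> quad_order l \<and> s \<in> S}"

definition ideal_times :: "complex set \<Rightarrow> complex set \<Rightarrow> complex set" where
  "ideal_times I J = group_closure {\<alpha> * \<beta> | \<alpha> \<beta>. \<alpha> \<in> I \<and> \<beta> \<in> J}"

definition Q_ideal :: "nat \<Rightarrow> complex set" where
  "Q_ideal l = ideal_generated l {2, (1 - sqrt_minus l) / 2}"

primrec Q_power :: "nat \<Rightarrow> nat \<Rightarrow> complex set" where
  "Q_power l 0 = quad_order l"
| "Q_power l (Suc r) = ideal_times (Q_ideal l) (Q_power l r)"


section \<open>The lattices and their reductions\<close>

definition integer_vectors :: "(real ^ 'n) set" where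
  "integer_vectors = {a. \<forall>\<mu>. a $ \<mu> \<in> \<int>}"

definition L_zero :: "(real ^ ('l::finite coord)) set" where
  "L_zero = {a \<in> integer_vectors. \<exists>k::int. (\<Sum>\<mu>\<in>UNIV. a $ \<mu>) = 2 * of_int k}"

definition L_plus :: "(real ^ ('l::finite coord)) set" where
  "L_plus = L_zero \<union> {(1 / 2) *\<^sub>R (axis None 1 v* (mat 1 + paley)) + a | a. a \<in> L_zero}"

definition Q_power_L_plus :: "nat \<Rightarrow> (real ^ ('l::finite coord)) set" where
  "Q_power_L_plus r =
     group_closure {act \<alpha> v | \<alpha> v. \<alpha> \<in> Q_power CARD('l) r \<and> v \<in> L_plus}"

text \<open>
  Coordinatewise reduction of integer vectors modulo \<open>CARD('m)\<close>; the floor only serves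
  to view an integral real number as an integer.
\<close>

definition reduce_vec :: "real ^ 'n \<Rightarrow> ('m::nontriv mod_ring) ^ 'n" where
  "reduce_vec a = (\<chi> \<mu>. of_int \<lfloor>a $ \<mu>\<rfloor>)"

definition reduced_code :: "nat \<Rightarrow> (('m::nontriv mod_ring) ^ ('l::finite coord)) set" where
  "reduced_code r = reduce_vec ` Q_power_L_plus r"

definition delete_infinity ::
  "('m::nontriv mod_ring) ^ ('l::finite coord) \<Rightarrow> ('m mod_ring) ^ ('l mod_ring)" where
  "delete_infinity c = (\<chi> j. c $ Some j)"


section \<open>Lifted quadratic residue codes\<close>

definition primitive_root_of_one :: "nat \<Rightarrow> 'k::field \<Rightarrow> bool" where
  "primitive_root_of_one l \<zeta> \<longleftrightarrow> \<zeta> ^ l = 1 \<and> (\<forall>k. 0 < k \<and> k < l \<longrightarrow> \<zeta> ^ k \<noteq> 1)"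

definition f_plus :: "nat \<Rightarrow> 'k::field \<Rightarrow> 'k poly" where
  "f_plus l \<zeta> = (\<Prod>j | j < l \<and> Legendre (int j) (int l) = 1. [:- (\<zeta> ^ j), 1:])"

definition f_minus :: "nat \<Rightarrow> 'k::field \<Rightarrow> 'k poly" where
  "f_minus l \<zeta> = (\<Prod>j | j < l \<and> Legendre (int j) (int l) = - 1. [:- (\<zeta> ^ j), 1:])"

text \<open>
  Reduction modulo 2 of polynomials over \<open>\<int>/2\<^sup>r\<int>\<close>, with values in the polynomials over
  a field of characteristic 2. It is a ring homomorphism when \<open>CARD('m)\<close> is even.
\<close>

definition reduce_poly_mod2 :: "'m::nontriv mod_ring poly \<Rightarrow> 'k::field poly" where
  "reduce_poly_mod2 = map_poly (\<lambda>x. of_int (to_int_mod_ring x))"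

text \<open>
  The defining properties of the pair of Hensel lifts of \<open>f_plus\<close> and \<open>f_minus\<close>.
  The pair is unique among monic polynomials; without that normalization the factors are
  determined up to mutually inverse units, which does not affect the ideals they generate.
\<close>

definition lifts_qr_factors ::
  "nat \<Rightarrow> 'k::field \<Rightarrow> 'm::nontriv mod_ring poly \<Rightarrow> 'm mod_ring poly \<Rightarrow> bool" where
  "lifts_qr_factors l \<zeta> F G \<longleftrightarrow>
     Polynomial.monom 1 l - 1 = [:- 1, 1:] * F * G \<and>
     reduce_poly_mod2 F = f_plus l \<zeta> \<and>
     reduce_poly_mod2 G = f_minus l \<zeta>"

definition vec_poly :: "('m::nontriv mod_ring) ^ ('l::finite mod_ring) \<Rightarrow> 'm mod_ring poly" where
  "vec_poly c = (\<Sum>j\<in>UNIV. Polynomial.monom (c $ j) (nat (to_int_mod_ring j)))"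

text \<open>
  The ideal generated by the class of \<open>g\<close> in the quotient by \<open>X\<^sup>l - 1\<close>: membership of the
  class of \<open>vec_poly c\<close> means congruence to a multiple of \<open>g\<close> modulo \<open>X\<^sup>l - 1\<close>.
\<close>

definition cyclic_code ::
  "'m::nontriv mod_ring poly \<Rightarrow> (('m mod_ring) ^ ('l::finite mod_ring)) set" where
  "cyclic_code g = {c. \<exists>q. (Polynomial.monom 1 CARD('l) - 1) dvd (vec_poly c - q * g)}"

end

(* Let omega = (1 - sqrt (-l)) / 2, a root of X^2 - X + m with m = (l + 1) / 4 even, and let a be the
   even root of this polynomial modulo 2^r. Then Q^r consists of the p + q omega with 2^r | p + q a, so
   Q^r L_+ is generated by 2^r L_+ and (omega - a) L_+. Away from the coordinate infinity, omega - a acts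
   on a vector v of L_0 with coordinate sum 2k as cyclic convolution of v with E = (1 - a) + N, N the sum
   of the X^n over the nonresidues n, followed by subtraction of k J, where J = 1 + X + ... + X^(l-1).
   Hence C_r' is the ideal (E, J).

   Put E' = (1 - a) + R with R the sum over the residues. The Jacobi sums of the Legendre symbol give
   N R = m + (m - 1) J modulo X^l - 1, whence E E' = a^2 - a + m + (m - a) J is a multiple of J modulo 2^r,
   and E + E' = 1 - 2a + J. The normalization of zeta says N(zeta) = 1, so modulo 2 the polynomial f_+
   divides E and f_- divides E'. As J = F_+ F_- and 2 is nilpotent, (E', F_+) and (E, F_-) are both the
   unit ideal; the former gives F_+ | E, the latter F_+ in (E, J). *)

theory Submission
  imports Defs
begin

section \<open>Sums of Legendre symbols\<close>

text \<open>Since \<open>u\<close> is a unit modulo \<open>l\<close>, the map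
  \<open>j \<mapsto> u * j + b\<close> permutes the residues, and a periodic \<open>h\<close> sees
  only residues.\<close>

lemma sum_periodic_affine:
  fixes h :: "int \<Rightarrow> 'a::comm_monoid_add"
  assumes per: "\<And>x. h (x mod int l) = h x" and cop: "coprime u (int l)"
  shows "(\<Sum>j<l. h (u * int j + b)) = (\<Sum>j<l. h (int j))"
proof (cases "l = 0")
  case False
  define g where "g j = nat ((u * int j + b) mod int l)" for j
  have g_int: "int (g j) = (u * int j + b) mod int l" for j
    using False by (simp add: g_def)
  have "inj_on g {..<l}"
  proof (rule inj_onI)
    fix i j assume ij: "i \<in> {..<l}" "j \<in> {..<l}" "g i = g j"
    then have "[u * int i + b = u * int j + b] (mod int l)"
      by (simp add: cong_def flip: g_int)
    then have "[int i = int j] (mod int l)"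
      using cop by (simp add: cong_add_rcancel cong_mult_lcancel)
    then show "i = j"
      using ij by (simp add: cong_int_iff cong_less_modulus_unique_nat)
  qed
  moreover have "g ` {..<l} \<subseteq> {..<l}"
    using False by (auto simp: g_def nat_less_iff)
  ultimately have "bij_betw g {..<l} {..<l}"
    by (simp add: bij_betw_def endo_inj_surj)
  then have "(\<Sum>j<l. h (int (g j))) = (\<Sum>j<l. h (int j))"
    by (rule sum.reindex_bij_betw)
  then show ?thesis
    by (simp add: g_int per)
qed simp

lemma Legendre_mod [simp]: "Legendre (a mod p) p = Legendre a p"
  by (simp add: Legendre_def QuadRes_def cong_def)

lemma Legendre_eq_0_iff: "Legendre a p = 0 \<longleftrightarrow> p dvd a"
  by (auto simp: Legendre_def cong_0_iff)

lemma Legendre_cases: "Legendre a p = 1 \<or> Legendre a p = 0 \<or> Legendre a p = -1"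
  by (simp add: Legendre_def)

text \<open>Euler's criterion gives the congruence modulo \<open>p\<close>. Both sides lie in {-1,
  0, 1}, so they differ by at most 2, which is less than \<open>p\<close>.\<close>

lemma Legendre_mult:
  assumes "prime p" "2 < p"
  shows "Legendre (a * b) (int p) = Legendre a (int p) * Legendre b (int p)"
proof -
  have "[Legendre (a * b) (int p) = (a * b) ^ ((p - 1) div 2)] (mod int p)"
    using assms by (rule euler_criterion)
  moreover have "[Legendre a (int p) * Legendre b (int p) = a ^ ((p - 1) div 2) * b ^ ((p - 1) div 2)] (mod int p)"
    using assms by (intro cong_mult euler_criterion)
  ultimately have "[Legendre (a * b) (int p) = Legendre a (int p) * Legendre b (int p)] (mod int p)"
    by (metis cong_sym cong_trans power_mult_distrib)
  then have "int p dvd Legendre (a * b) (int p) - Legendre a (int p) * Legendre b (int p)"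
    by (simp add: cong_iff_dvd_diff)
  moreover have "\<bar>Legendre (a * b) (int p) - Legendre a (int p) * Legendre b (int p)\<bar> < int p"
    using Legendre_cases[of "a * b" "int p"] Legendre_cases[of a "int p"] Legendre_cases[of b "int p"] assms
    by auto
  ultimately show ?thesis
    using zdvd_imp_le[of "int p" "\<bar>Legendre (a * b) (int p) - Legendre a (int p) * Legendre b (int p)\<bar>"]
    by (metis dvd_abs_iff eq_iff_diff_eq_0 linorder_not_less zero_less_abs_iff)
qed

text \<open>Euler's criterion with the exponent \<open>(p - 1) div 2\<close>, which is odd
  here.\<close>

lemma Legendre_minus_one:
  assumes "prime p" "[p = 3] (mod 4)"
  shows "Legendre (-1) (int p) = -1"
proof -
  have "p mod 4 = 3" using assms by (simp add: cong_def)
  then have p2: "2 < p" and odd: "odd ((p - 1) div 2)"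
    using mod_less_eq_dividend[of p 4] by (auto, presburger)
  from euler_criterion[OF assms(1) p2, of "-1"] odd
  have "int p dvd Legendre (-1) (int p) + 1"
    by (simp add: cong_iff_dvd_diff)
  then show ?thesis
    using Legendre_cases[of "-1" "int p"] zdvd_imp_le[of "int p"] p2 by force
qed

lemma Legendre_uminus:
  assumes "prime p" "[p = 3] (mod 4)"
  shows "Legendre (- a) (int p) = - Legendre a (int p)"
proof -
  have "p mod 4 = 3" using assms by (simp add: cong_def)
  then have "2 < p" using mod_less_eq_dividend[of p 4] by auto
  then have "Legendre ((-1) * a) (int p) = Legendre (-1) (int p) * Legendre a (int p)"
    using assms(1) Legendre_mult by blast
  then show ?thesis using Legendre_minus_one[OF assms] by simp
qed

text \<open>The substitution \<open>j \<mapsto> - j\<close> reverses every sign, so the sum equals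
  its own negative.\<close>

lemma sum_Legendre:
  assumes "prime p" "[p = 3] (mod 4)"
  shows "(\<Sum>j<p. Legendre (int j) (int p)) = 0"
proof -
  have "(\<Sum>j<p. Legendre ((-1) * int j + 0) (int p)) = (\<Sum>j<p. Legendre (int j) (int p))"
    by (rule sum_periodic_affine) auto
  then show ?thesis
    by (simp add: Legendre_uminus[OF assms] sum_negf)
qed

lemma sum_Legendre_square:
  assumes "prime p"
  shows "(\<Sum>j<p. (Legendre (int j) (int p))\<^sup>2) = int p - 1"
proof -
  have "(Legendre (int j) (int p))\<^sup>2 = (if j = 0 then 0 else 1)" if "j < p" for j
    using Legendre_cases[of "int j" "int p"] Legendre_eq_0_iff[of "int j" "int p"] that nat_dvd_not_less[of j p]
    by auto
  then have "(\<Sum>j<p. (Legendre (int j) (int p))\<^sup>2) = (\<Sum>j<p. if j = 0 then 0 else 1)"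
    by (intro sum.cong) auto
  also have "\<dots> = (\<Sum>j\<in>{..<p} - {0}. 1)"
    by (intro sum.mono_neutral_cong_right) auto
  finally show ?thesis using prime_gt_0_nat[OF assms] by (simp add: card_Diff_singleton)
qed

text \<open>A Jacobi sum in additive form. The value \<open>T 0\<close> is minus the number of units
  because -1 is a nonresidue; the common value on the units then follows because all values together
  sum to 0.\<close>

lemma sum_Legendre_convolution:
  assumes "prime p" "[p = 3] (mod 4)"
  shows "(\<Sum>i<p. Legendre (int i) (int p) * Legendre (k - int i) (int p)) =
    (if int p dvd k then 1 - int p else 1)"
proof -
  define T where "T k = (\<Sum>i<p. Legendre (int i) (int p) * Legendre (k - int i) (int p))" for k
  have "p mod 4 = 3" using assms by (simp add: cong_def)
  then have p2: "2 < p" using mod_less_eq_dividend[of p 4] by auto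
  have per: "Legendre (x mod int p) (int p) * Legendre (k - x mod int p) (int p) =
      Legendre x (int p) * Legendre (k - x) (int p)" for k x
    by (metis Legendre_mod mod_diff_right_eq)
  have T_mod: "T (k mod int p) = T k" for k
    unfolding T_def by (metis Legendre_mod mod_diff_left_eq)
  have T0: "T 0 = 1 - int p"
    using sum_Legendre_square[OF assms(1)]
    by (simp add: T_def Legendre_uminus[OF assms] sum_negf power2_eq_square)
  \<comment> \<open>Substituting \<open>i \<mapsto> u i\<close> shows that \<open>T\<close> is constant on the units.\<close>
  have T_unit: "T u = T 1" if "\<not> int p dvd u" for u
  proof -
    have cop: "coprime u (int p)"
      using that assms(1) by (metis coprime_commute prime_imp_coprime prime_int_nat_transfer of_nat_0_le_iff nat_int)
    have "T u = (\<Sum>i<p. Legendre (u * int i + 0) (int p) * Legendre (u - (u * int i + 0)) (int p))"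
      unfolding T_def by (rule sum_periodic_affine[symmetric]) (use per cop in auto)
    also have "\<dots> = (\<Sum>i<p. (Legendre u (int p))\<^sup>2 * (Legendre (int i) (int p) * Legendre (1 - int i) (int p)))"
    proof (rule sum.cong[OF refl])
      fix i
      have "u - (u * int i + 0) = u * (1 - int i)" by (simp add: algebra_simps)
      then show "Legendre (u * int i + 0) (int p) * Legendre (u - (u * int i + 0)) (int p) =
          (Legendre u (int p))\<^sup>2 * (Legendre (int i) (int p) * Legendre (1 - int i) (int p))"
        by (simp only: Legendre_mult[OF assms(1) p2] power2_eq_square) (simp add: Legendre_mult[OF assms(1) p2])
    qed
    also have "(Legendre u (int p))\<^sup>2 = 1"
      using that Legendre_cases[of u "int p"] Legendre_eq_0_iff[of u "int p"] by auto
    finally show ?thesis by (simp add: T_def)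
  qed
  \<comment> \<open>After the swap the inner sum over \<open>k\<close> is a shifted full character
    sum, hence 0.\<close>
  have "(\<Sum>k<p. T (int k)) = (\<Sum>i<p. \<Sum>k<p. Legendre (int i) (int p) * Legendre (int k - int i) (int p))"
    unfolding T_def by (rule sum.swap)
  also have "\<dots> = (\<Sum>i<p. Legendre (int i) (int p) * (\<Sum>k<p. Legendre (1 * int k + (- int i)) (int p)))"
    by (simp add: sum_distrib_left)
  also have "\<dots> = 0"
    by (subst sum_periodic_affine) (auto simp: sum_Legendre[OF assms])
  finally have "0 = (\<Sum>k<p. T (int k))" by simp
  also have "\<dots> = T 0 + (\<Sum>k\<in>{..<p} - {0}. T (int k))"
    by (subst sum.remove[of _ 0]) (use p2 in auto)
  also have "(\<Sum>k\<in>{..<p} - {0}. T (int k)) = (\<Sum>k\<in>{..<p} - {0}. T 1)"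
  proof (rule sum.cong[OF refl])
    fix k assume "k \<in> {..<p} - {0}"
    then have "\<not> p dvd k" using nat_dvd_not_less by auto
    then show "T (int k) = T 1" by (intro T_unit) simp
  qed
  also have "\<dots> = (int p - 1) * T 1"
    using p2 by (simp add: card_Diff_singleton)
  finally have "(int p - 1) * (T 1 - 1) = 0"
    using T0 by (simp add: algebra_simps)
  then have "T 1 = 1" using p2 by simp
  moreover have "T k = T 0" if "int p dvd k"
    using T_mod[of k] that by (simp add: dvd_eq_mod_eq_0)
  ultimately show ?thesis
    using T0 T_unit[of k] unfolding T_def by metis
qed

text \<open>For a sign \<open>e\<close>, the indicator of the symbol being \<open>e\<close> is half
  of its square plus \<open>e\<close> times itself, so the count comes from the two character
  sums.\<close>

lemma card_Legendre:
  assumes "prime p" "[p = 3] (mod 4)" "e = 1 \<or> e = -1"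
  shows "card {j. j < p \<and> Legendre (int j) (int p) = e} = (p - 1) div 2"
proof -
  have "2 * (of_bool (Legendre (int j) (int p) = e) :: int) =
      (Legendre (int j) (int p))\<^sup>2 + e * Legendre (int j) (int p)" for j
    using Legendre_cases[of "int j" "int p"] assms(3) by auto
  then have "2 * (\<Sum>j<p. of_bool (Legendre (int j) (int p) = e) :: int) =
      (\<Sum>j<p. (Legendre (int j) (int p))\<^sup>2) + e * (\<Sum>j<p. Legendre (int j) (int p))"
    by (simp only: sum_distrib_left flip: sum.distrib)
  also have "\<dots> = int p - 1"
    by (simp add: sum_Legendre_square sum_Legendre assms)
  also have "(\<Sum>j<p. of_bool (Legendre (int j) (int p) = e) :: int) =
      int (card {j. j < p \<and> Legendre (int j) (int p) = e})"
    by (simp add: of_bool_def sum.If_cases lessThan_def Collect_conj_eq[symmetric])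
  finally show ?thesis using prime_gt_0_nat[OF assms(1)] by linarith
qed

text \<open>Hensel lifting from the root 0 modulo 2. The derivative \<open>2 * a - 1\<close> is odd,
  so replacing \<open>a\<close> by \<open>a + 2 ^ r\<close> flips the parity of the cofactor
  \<open>t\<close> and keeps \<open>a\<close> even.\<close>

lemma even_quadratic_root_mod_two_power:
  fixes m :: int
  assumes "even m" "r \<ge> 1"
  shows "\<exists>a. even a \<and> 2 ^ r dvd a\<^sup>2 - a + m"
  using assms(2)
proof (induction r rule: nat_induct_at_least)
  case base
  show ?case using assms(1) by (intro exI[of _ 0]) simp
next
  case (Suc r)
  then obtain a t where a: "even a" "a\<^sup>2 - a + m = 2 ^ r * t" by (auto elim: dvdE)
  show ?case
  proof (cases "even t")
    case True
    then show ?thesis using a by (intro exI[of _ a]) (auto simp: mult.commute[of 2] mult_dvd_mono)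
  next
    case False
    have "(a + 2 ^ r)\<^sup>2 - (a + 2 ^ r) + m = 2 ^ r * (t - 1 + 2 * a + 2 ^ r)"
      using a(2) by (simp add: power2_eq_square algebra_simps)
    moreover have "even (t - 1 + 2 * a + 2 ^ r)" using False Suc.hyps by simp
    ultimately show ?thesis using a(1) Suc.hyps
      by (intro exI[of _ "a + 2 ^ r"]) (auto simp: mult.commute[of 2] intro: mult_dvd_mono)
  qed
qed

section \<open>Polynomials modulo $X^l - 1$\<close>

text \<open>Over rings with zero divisors a monic factor can still be cancelled, since leading
  coefficients multiply without vanishing.\<close>

lemma monic_mult_eq_0_iff:
  fixes p q :: "'a::comm_ring_1 poly"
  assumes "lead_coeff p = 1"
  shows "p * q = 0 \<longleftrightarrow> q = 0"
proof
  assume "p * q = 0"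
  then have "lead_coeff p * lead_coeff q = 0"
    by (metis coeff_mult_degree_sum coeff_0)
  with assms show "q = 0" by simp
qed simp

lemma degree_monom_minus_1:
  "l > 0 \<Longrightarrow> Polynomial.degree (Polynomial.monom 1 l - 1 :: 'a::comm_ring_1 poly) = l"
  by (intro antisym degree_le le_degree) (auto simp: coeff_eq_0)

lemma monic_monom_minus_1:
  "l > 0 \<Longrightarrow> lead_coeff (Polynomial.monom 1 l - 1 :: 'a::comm_ring_1 poly) = 1"
  by (simp add: degree_monom_minus_1 coeff_eq_0)

text \<open>A nonzero multiple of a monic polynomial of degree \<open>l\<close> has degree at least
  \<open>l\<close>. Hence a class modulo \<open>X^l - 1\<close> has only one representative of
  degree below \<open>l\<close>.\<close>

lemma monom_minus_1_dvd_imp_0: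
  fixes p :: "'a::comm_ring_1 poly"
  assumes "Polynomial.monom 1 l - 1 dvd p" "\<forall>i\<ge>l. Polynomial.coeff p i = 0" "l > 0"
  shows "p = 0"
proof (rule ccontr)
  assume "p \<noteq> 0"
  obtain q where q: "p = (Polynomial.monom 1 l - 1) * q" using assms(1) by blast
  with \<open>p \<noteq> 0\<close> have "q \<noteq> 0" by auto
  with q have "Polynomial.degree p = l + Polynomial.degree q"
    using degree_monic_mult[of "Polynomial.monom 1 l - 1" q] degree_monom_minus_1[where ?'a='a]
      monic_monom_minus_1[where ?'a='a] assms(3) by simp
  with assms(2) \<open>p \<noteq> 0\<close> show False by (metis le_add1 leading_coeff_0_iff)
qed

lemma monom_mod_unity:
  "Polynomial.monom 1 l - 1 dvd Polynomial.monom c n - Polynomial.monom (c::'a::comm_ring_1) (n mod l)"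
proof -
  have "Polynomial.monom c n = Polynomial.monom c (n mod l) * Polynomial.monom 1 l ^ (n div l)"
    by (simp add: mult_monom monom_power)
  then have "Polynomial.monom c n - Polynomial.monom c (n mod l) =
      Polynomial.monom c (n mod l) * (Polynomial.monom 1 l ^ (n div l) - 1)"
    by (simp add: algebra_simps)
  then show ?thesis by (simp add: power_diff_1_eq)
qed

text \<open>The index function is defined on all integers, so that functions of residues such as
  Legendre symbols can be evaluated at differences of indices.\<close>

definition per_poly :: "nat \<Rightarrow> (int \<Rightarrow> 'a) \<Rightarrow> 'a::comm_ring_1 poly" where
  "per_poly l h = (\<Sum>j<l. Polynomial.monom (h (int j)) j)"

lemma monom_sum: "Polynomial.monom (sum f A) n = (\<Sum>i\<in>A. Polynomial.monom (f i) n)"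
  by (rule poly_eqI) (simp add: coeff_sum)

lemma coeff_per_poly: "Polynomial.coeff (per_poly l h) n = (if n < l then h (int n) else 0)"
  by (simp add: per_poly_def coeff_sum coeff_monom sum.If_cases)

lemma poly_per_poly: "poly (per_poly l h) x = (\<Sum>j<l. h (int j) * x ^ j)"
  by (simp add: per_poly_def poly_sum poly_monom)

lemma per_poly_add: "per_poly l g + per_poly l h = per_poly l (\<lambda>x. g x + h x)"
  by (rule poly_eqI) (simp add: coeff_per_poly)

lemma smult_per_poly: "Polynomial.smult c (per_poly l h) = per_poly l (\<lambda>x. c * h x)"
  by (rule poly_eqI) (simp add: coeff_per_poly)

lemma per_poly_cong:
  "(\<And>j. j < l \<Longrightarrow> g (int j) = h (int j)) \<Longrightarrow> per_poly l g = per_poly l h"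
  by (simp add: per_poly_def)

lemma per_poly_delta: "l > 0 \<Longrightarrow> per_poly l (\<lambda>x. if int l dvd x then c else 0) = [:c:]"
  by (rule poly_eqI) (auto simp: coeff_per_poly coeff_pCons split: nat.splits dest: nat_dvd_not_less)

text \<open>Multiplication modulo \<open>X^l - 1\<close> is cyclic convolution. Only
  \<open>e\<close> is evaluated outside the range from 0 to \<open>l - 1\<close>, so periodicity is
  asked of \<open>e\<close> alone.\<close>

lemma per_poly_mult_cong:
  fixes \<alpha> e :: "int \<Rightarrow> 'a::comm_ring_1"
  assumes per: "\<And>x. e (x mod int l) = e x"
  shows "Polynomial.monom 1 l - 1 dvd
    per_poly l \<alpha> * per_poly l e - per_poly l (\<lambda>m. \<Sum>i<l. \<alpha> (int i) * e (m - int i))"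
proof (cases "l = 0")
  case False
  have shift: "(\<Sum>j<l. Polynomial.monom (\<alpha> (int i) * e (int j)) ((i + j) mod l)) =
      (\<Sum>m<l. Polynomial.monom (\<alpha> (int i) * e (int m - int i)) m)" for i
  proof -
    \<comment> \<open>With the exponent reduced modulo \<open>l\<close>, the whole monomial is a
      periodic function of \<open>x\<close>, and the shift by \<open>i\<close> becomes an affine
      substitution.\<close>
    define h where "h x = Polynomial.monom (\<alpha> (int i) * e (x - int i)) (nat (x mod int l))" for x
    have "(\<Sum>j<l. h (1 * int j + int i)) = (\<Sum>j<l. h (int j))"
      by (rule sum_periodic_affine) (auto simp: h_def, metis per mod_diff_left_eq)
    moreover have "nat ((int j + int i) mod int l) = (i + j) mod l" for j
      by (simp add: add.commute nat_mod_distrib nat_add_distrib)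
    then have "h (1 * int j + int i) = Polynomial.monom (\<alpha> (int i) * e (int j)) ((i + j) mod l)" for j
      by (simp add: h_def)
    ultimately show ?thesis by (simp add: h_def)
  qed
  have "per_poly l \<alpha> * per_poly l e =
      (\<Sum>i<l. \<Sum>j<l. Polynomial.monom (\<alpha> (int i) * e (int j)) (i + j))"
    by (simp add: per_poly_def sum_product mult_monom)
  moreover have "per_poly l (\<lambda>m. \<Sum>i<l. \<alpha> (int i) * e (m - int i)) =
      (\<Sum>i<l. \<Sum>j<l. Polynomial.monom (\<alpha> (int i) * e (int j)) ((i + j) mod l))"
    unfolding shift per_poly_def by (subst sum.swap) (simp add: monom_sum)
  ultimately have "per_poly l \<alpha> * per_poly l e - per_poly l (\<lambda>m. \<Sum>i<l. \<alpha> (int i) * e (m - int i)) =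
      (\<Sum>i<l. \<Sum>j<l. Polynomial.monom (\<alpha> (int i) * e (int j)) (i + j) -
        Polynomial.monom (\<alpha> (int i) * e (int j)) ((i + j) mod l))"
    by (simp add: sum_subtractf)
  also have "Polynomial.monom 1 l - 1 dvd \<dots>"
    by (intro dvd_sum monom_mod_unity)
  finally show ?thesis .
qed (simp add: per_poly_def)

text \<open>Pseudo-division multiplies the dividend by a power of the leading coefficient, which is
  1 here; this gives division with remainder over any commutative ring.\<close>

lemma monic_division:
  fixes f g :: "'a::comm_ring_1 poly"
  assumes "lead_coeff g = 1"
  obtains q r where "f = g * q + r" "r = 0 \<or> Polynomial.degree r < Polynomial.degree g"
proof -
  obtain q r where qr: "pseudo_divmod f g = (q, r)" by fastforce
  have "g \<noteq> 0" using assms by auto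
  from pseudo_divmod[OF this qr] that[of q r] assms show ?thesis by simp
qed

lemma exists_per_poly_cong:
  fixes p :: "'a::comm_ring_1 poly"
  assumes "l > 0"
  obtains \<alpha> where "Polynomial.monom 1 l - 1 dvd p - per_poly l \<alpha>"
proof -
  obtain q r where qr: "p = (Polynomial.monom 1 l - 1) * q + r" "r = 0 \<or> Polynomial.degree r < l"
    by (rule monic_division[OF monic_monom_minus_1[OF assms], unfolded degree_monom_minus_1[OF assms]])
  then have "r = per_poly l (\<lambda>x. Polynomial.coeff r (nat x))"
    by (auto simp: poly_eq_iff coeff_per_poly coeff_eq_0)
  with qr(1) have "p - per_poly l (\<lambda>x. Polynomial.coeff r (nat x)) = (Polynomial.monom 1 l - 1) * q"
    by (metis add_diff_cancel_right')
  then have "Polynomial.monom 1 l - 1 dvd p - per_poly l (\<lambda>x. Polynomial.coeff r (nat x))"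
    by simp
  then show ?thesis by (rule that)
qed

lemma per_poly_one_mult: "[:- 1, 1:] * per_poly l (\<lambda>_. 1) = (Polynomial.monom 1 l - 1 :: 'a::comm_ring_1 poly)"
proof (induction l)
  case 0
  show ?case by (simp add: per_poly_def)
next
  case (Suc l)
  have "[:- 1, 1:] * Polynomial.monom (1::'a) l = Polynomial.monom 1 (Suc l) - Polynomial.monom 1 l"
    by (simp add: monom_Suc)
  then show ?case using Suc by (simp add: per_poly_def distrib_left algebra_simps)
qed

text \<open>Modulo \<open>X^l - 1\<close> the all-one polynomial is annihilated by
  \<open>X - 1\<close>, so \<open>p\<close> acts on it through \<open>p\<close> modulo
  \<open>X - 1\<close>, that is, through its value at 1.\<close>

lemma per_poly_one_absorb:
  fixes p :: "'a::comm_ring_1 poly"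
  shows "Polynomial.monom 1 l - 1 dvd p * per_poly l (\<lambda>_. 1) - Polynomial.smult (poly p 1) (per_poly l (\<lambda>_. 1))"
proof -
  have "p = [:- 1, 1:] * synthetic_div p 1 + [:poly p 1:]"
    using synthetic_div_correct'[of 1 p] by simp
  then have "p * per_poly l (\<lambda>_. 1) =
      ([:- 1, 1:] * synthetic_div p 1 + [:poly p 1:]) * per_poly l (\<lambda>_. 1)" by simp
  also have "\<dots> = ([:- 1, 1:] * per_poly l (\<lambda>_. 1)) * synthetic_div p 1 + Polynomial.smult (poly p 1) (per_poly l (\<lambda>_. 1))"
    by (simp add: algebra_simps)
  finally show ?thesis by (simp only: per_poly_one_mult) simp
qed

section \<open>Generating polynomials of the residues (\<open>e = 1\<close>) and nonresidues
  (\<open>e = -1\<close>), and their product\<close>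

abbreviation chi_poly :: "nat \<Rightarrow> int \<Rightarrow> 'a::comm_ring_1 poly" where
  "chi_poly l e \<equiv> per_poly l (\<lambda>x. of_bool (Legendre x (int l) = e))"

lemma chi_poly_sum:
  assumes "l > 0"
  shows "1 + chi_poly l 1 + chi_poly l (-1) = per_poly l (\<lambda>_. 1)"
proof -
  have one: "(1 :: 'a poly) = per_poly l (\<lambda>x. if int l dvd x then 1 else 0)"
    using per_poly_delta[OF assms, of "1::'a"] by (simp add: one_pCons)
  have "1 + chi_poly l 1 + chi_poly l (-1) = (per_poly l (\<lambda>x. (if int l dvd x then 1 else 0) +
      of_bool (Legendre x (int l) = 1) + of_bool (Legendre x (int l) = -1)) :: 'a poly)"
    by (subst one) (simp only: per_poly_add)
  also have "\<dots> = per_poly l (\<lambda>_. 1)"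
  proof (rule per_poly_cong)
    fix j
    show "(if int l dvd int j then 1 else 0) + of_bool (Legendre (int j) (int l) = 1) +
        of_bool (Legendre (int j) (int l) = -1) = (1::'a)"
      using Legendre_cases[of "int j" "int l"] Legendre_eq_0_iff[of "int j" "int l"] by auto
  qed
  finally show ?thesis .
qed

text \<open>This counts the ways to write \<open>k\<close> as a nonresidue plus a residue. With
  \<open>?d\<close> the indicator of 0 and \<open>?c\<close> the symbol, the two indicators are
  \<open>(1 - ?d - ?c) / 2\<close> and \<open>(1 - ?d + ?c) / 2\<close>. In the expanded product the
  two contributions \<open>?c k\<close> cancel and only the Jacobi sum remains.\<close>

lemma Legendre_pair_count:
  assumes "prime l" "[l = 3] (mod 4)"
  shows "(\<Sum>i<l. of_bool (Legendre (int i) (int l) = -1) * of_bool (Legendre (k - int i) (int l) = 1)) =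
    (if int l dvd k then int ((l + 1) div 4) else 0) + (int ((l + 1) div 4) - 1)"
proof -
  let ?c = "\<lambda>x. Legendre x (int l)"
  let ?d = "\<lambda>x. of_bool (int l dvd x) :: int"
  have l0: "l > 0" using assms(1) prime_gt_0_nat by blast
  have d0: "(\<Sum>i<l. ?d (int i) * g (int i)) = g 0" for g :: "int \<Rightarrow> int"
  proof -
    have "(\<Sum>i<l. ?d (int i) * g (int i)) = (\<Sum>i<l. if i = 0 then g 0 else 0)"
      by (rule sum.cong) (auto dest: nat_dvd_not_less)
    then show ?thesis using l0 by simp
  qed
  have reflect: "(\<Sum>i<l. h (k - int i)) = (\<Sum>i<l. h (int i))"
    if "\<And>x. h (x mod int l) = h x" for h :: "int \<Rightarrow> int"
    using sum_periodic_affine[of h l "-1" k] that by simp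
  have dk: "(\<Sum>i<l. ?d (k - int i) * ?c (int i)) = ?c k"
  proof -
    have "?c (k - x mod int l) = ?c (k - x)" for x
      by (metis Legendre_mod mod_diff_right_eq)
    then have "(\<Sum>i<l. ?d (k - int i) * ?c (k - (k - int i))) = (\<Sum>i<l. ?d (int i) * ?c (k - int i))"
      by (intro reflect) (simp add: dvd_mod_iff)
    then show ?thesis using d0[of "\<lambda>x. ?c (k - x)"] by simp
  qed
  have dk1: "(\<Sum>i<l. ?d (k - int i)) = 1"
    using reflect[of ?d] d0[of "\<lambda>_. 1"] by (simp add: dvd_mod_iff)
  have ck: "(\<Sum>i<l. ?c (k - int i)) = 0"
    using reflect[of ?c] sum_Legendre[OF assms] by simp
  have d0': "(\<Sum>i<l. ?d (int i) * (1 - ?d (k - int i) + ?c (k - int i))) = 1 - ?d k + ?c k"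
    using d0[of "\<lambda>x. 1 - ?d (k - x) + ?c (k - x)"] by (simp only: diff_zero)
  have "4 * (of_bool (?c x = -1) * of_bool (?c y = 1) :: int) =
      1 - ?d y + ?c y - ?d x * (1 - ?d y + ?c y) - ?c x + ?d y * ?c x - ?c x * ?c y" for x y
    using Legendre_cases[of x "int l"] Legendre_cases[of y "int l"]
    unfolding Legendre_eq_0_iff[symmetric] by (elim disjE) simp_all
  then have "4 * (\<Sum>i<l. of_bool (?c (int i) = -1) * of_bool (?c (k - int i) = 1) :: int) =
      (\<Sum>i<l. 1 - ?d (k - int i) + ?c (k - int i) - ?d (int i) * (1 - ?d (k - int i) + ?c (k - int i))
        - ?c (int i) + ?d (k - int i) * ?c (int i) - ?c (int i) * ?c (k - int i))"
    by (simp only: sum_distrib_left)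
  also have "\<dots> = int l - 2 + ?d k - (if int l dvd k then 1 - int l else 1)"
    by (simp only: sum.distrib sum_subtractf dk dk1 ck d0' sum_Legendre[OF assms]
      sum_Legendre_convolution[OF assms]) simp
  also have "\<dots> = 4 * ((if int l dvd k then int ((l + 1) div 4) else 0) + (int ((l + 1) div 4) - 1))"
  proof -
    have "4 dvd l + 1" using assms(2) unfolding cong_def by presburger
    then have "4 * int ((l + 1) div 4) = int l + 1" by auto
    then show ?thesis by auto
  qed
  finally show ?thesis by simp
qed

text \<open>The coefficients of the product are the pair counts, transported from the integers to
  the ring by \<open>of_int\<close>.\<close>

lemma chi_poly_mult:
  assumes "prime l" "[l = 3] (mod 4)"
  shows "Polynomial.monom 1 l - 1 dvd chi_poly l (-1) * chi_poly l 1 -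
    ([:of_nat ((l + 1) div 4):] +
      Polynomial.smult (of_nat ((l + 1) div 4) - 1) (per_poly l (\<lambda>_. 1 :: 'a::comm_ring_1)))"
proof -
  have l0: "l > 0" using assms(1) prime_gt_0_nat by blast
  let ?m = "(l + 1) div 4"
  have "of_int (\<Sum>i<l. of_bool (Legendre (int i) (int l) = -1) * of_bool (Legendre (k - int i) (int l) = 1)) =
    (of_int ((if int l dvd k then int ?m else 0) + (int ?m - 1)) :: 'a)" for k
    by (simp only: Legendre_pair_count[OF assms])
  then have "(\<Sum>i<l. of_bool (Legendre (int i) (int l) = -1) * of_bool (Legendre (k - int i) (int l) = 1) :: 'a) =
    (if int l dvd k then of_nat ?m else 0) + (of_nat ?m - 1)" for k
    by (simp add: if_distrib[of of_int] cong: if_cong)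
  then have "per_poly l (\<lambda>k. \<Sum>i<l. of_bool (Legendre (int i) (int l) = -1) *
      of_bool (Legendre (k - int i) (int l) = 1)) =
    [:of_nat ?m:] + Polynomial.smult (of_nat ?m - 1) (per_poly l (\<lambda>_. 1 :: 'a))"
    by (simp only: per_poly_add[symmetric] per_poly_delta[OF l0] smult_per_poly mult_1_right)
  then show ?thesis
    using per_poly_mult_cong[of "\<lambda>x. of_bool (Legendre x (int l) = 1)" l "\<lambda>x. of_bool (Legendre x (int l) = -1) :: 'a"]
    by simp
qed

section \<open>Roots of unity and reduction modulo 2\<close>

lemma root_of_unity_power_mod:
  assumes "\<zeta> ^ l = (1::'k::field)"
  shows "\<zeta> ^ (n mod l) = \<zeta> ^ n"
proof -
  have "\<zeta> ^ n = \<zeta> ^ (l * (n div l) + n mod l)" by simp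
  also have "\<dots> = \<zeta> ^ (n mod l)" by (simp only: power_add power_mult assms) simp
  finally show ?thesis ..
qed

text \<open>Passing from \<open>\<zeta>\<close> to \<open>\<zeta> ^ j\<close> multiplies all
  exponents by \<open>j\<close>; this preserves the residues and nonresidues if \<open>j\<close> is
  a residue and exchanges them otherwise.\<close>

lemma poly_chi_poly_power:
  fixes \<zeta> :: "'k::field"
  assumes "prime l" "2 < l" "\<zeta> ^ l = 1" "Legendre (int j) (int l) \<noteq> 0"
  shows "poly (chi_poly l e) (\<zeta> ^ j) = poly (chi_poly l (Legendre (int j) (int l) * e)) \<zeta>"
proof -
  let ?c = "\<lambda>x. Legendre x (int l)"
  define h where "h x = of_bool (?c x = ?c (int j) * e) * \<zeta> ^ nat (x mod int l)" for x
  have cop: "coprime (int j) (int l)"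
    using assms(1,4) by (metis Legendre_eq_0_iff coprime_commute int_dvd_int_iff prime_imp_coprime_nat coprime_int_iff)
  have c: "?c (int j) = 1 \<or> ?c (int j) = -1" using Legendre_cases assms(4) by blast
  have "(\<Sum>i<l. h (int j * int i + 0)) = (\<Sum>i<l. h (int i))"
    by (rule sum_periodic_affine[OF _ cop]) (simp add: h_def)
  moreover have "h (int j * int i + 0) = of_bool (?c (int i) = e) * (\<zeta> ^ j) ^ i" for i
  proof -
    have "nat ((int j * int i) mod int l) = (j * i) mod l"
      by (simp add: nat_mod_distrib nat_mult_distrib)
    then show ?thesis
      using c by (auto simp: h_def Legendre_mult[OF assms(1,2)] root_of_unity_power_mod[OF assms(3)] power_mult)
  qed
  moreover have "h (int i) = of_bool (?c (int i) = ?c (int j) * e) * \<zeta> ^ i" if "i < l" for i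
    using that by (simp add: h_def)
  ultimately show ?thesis by (simp add: poly_per_poly)
qed

lemma primitive_root_inj:
  assumes "primitive_root_of_one l (\<zeta>::'k::field)"
  shows "inj_on (\<lambda>j. \<zeta> ^ j) {..<l}"
proof (rule linorder_inj_onI)
  fix i j assume ij: "i < j" "i \<in> {..<l}" "j \<in> {..<l}"
  then have "\<zeta> ^ l = 1" "\<zeta> ^ (j - i) \<noteq> 1" "l > 0"
    using assms by (auto simp: primitive_root_of_one_def)
  moreover from this have "\<zeta> ^ i \<noteq> 0" by (metis power_0_left power_not_zero zero_neq_one less_irrefl)
  moreover have "\<zeta> ^ j = \<zeta> ^ i * \<zeta> ^ (j - i)" using ij by (simp flip: power_add)
  ultimately show "\<zeta> ^ i \<noteq> \<zeta> ^ j" by simp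
qed auto

lemma prod_linear_dvd:
  fixes p :: "'k::field poly"
  assumes "finite S" "inj_on f S" "\<And>x. x \<in> S \<Longrightarrow> poly p (f x) = 0"
  shows "(\<Prod>x\<in>S. [:- f x, 1:]) dvd p"
  using assms
proof (induction S arbitrary: p rule: finite_induct)
  case (insert x S)
  obtain q where q: "p = [:- f x, 1:] * q"
    using insert.prems(2)[of x] by (auto simp: poly_eq_0_iff_dvd)
  have "(\<Prod>x\<in>S. [:- f x, 1:]) dvd q"
  proof (rule insert.IH)
    fix y assume "y \<in> S"
    then have "poly p (f y) = 0" using insert.prems(2) by auto
    moreover have "f y \<noteq> f x"
      using insert.prems(1) insert.hyps(2) \<open>y \<in> S\<close> by (metis inj_onD insertCI)
    ultimately show "poly q (f y) = 0" by (simp add: q)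
  qed (use insert.prems in auto)
  then show ?case
    unfolding q prod.insert[OF insert.hyps] by (rule mult_dvd_mono[OF dvd_refl])
qed simp

lemma degree_lead_coeff_prod_linear:
  fixes f :: "'b \<Rightarrow> 'k::field"
  shows "Polynomial.degree (\<Prod>x\<in>S. [:- f x, 1:]) = card S \<and> lead_coeff (\<Prod>x\<in>S. [:- f x, 1:]) = 1"
proof -
  have "lead_coeff (\<Prod>x\<in>S. [:- f x, 1:]) = 1" by (simp add: lead_coeff_prod)
  moreover have "Polynomial.degree (\<Prod>x\<in>S. [:- f x, 1:]) = card S"
    by (subst degree_prod_eq_sum_degree) auto
  ultimately show ?thesis by simp
qed

text \<open>Vieta's formula for the second highest coefficient; it turns the normalization of
  \<open>\<zeta>\<close> into a statement about a sum of powers of \<open>\<zeta>\<close>.\<close>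

lemma coeff_prod_linear:
  fixes f :: "'b \<Rightarrow> 'k::field"
  assumes "finite S" "S \<noteq> {}"
  shows "Polynomial.coeff (\<Prod>x\<in>S. [:- f x, 1:]) (card S - 1) = - (\<Sum>x\<in>S. f x)"
  using assms
proof (induction S rule: finite_ne_induct)
  case (insert x S)
  obtain n where n: "card S = Suc n" using insert by (cases "card S") auto
  \<comment> \<open>The new linear factor multiplies this leading coefficient by
    \<open>- f x\<close>, which is how the new root enters the sum.\<close>
  have "Polynomial.coeff (\<Prod>x\<in>S. [:- f x, 1:]) (Suc n) = 1"
    using degree_lead_coeff_prod_linear[of f S] n by metis
  then show ?case using insert n by simp
qed simp

section \<open>Reduction from the integers modulo a power of 2 to a field of characteristic
  2\<close>

context
  fixes r :: nat
  assumes card_m: "CARD('m::nontriv) = 2 ^ r" and r: "r \<ge> 1" and char_k: "CHAR('k::field) = 2"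
begin

lemma even_card: "even (int CARD('m))" using card_m r by simp

text \<open>Changing a representative modulo the even number \<open>CARD('m)\<close> is invisible in
  characteristic 2; this is what makes reduction a homomorphism.\<close>

lemma of_int_mod_card: "(of_int (z mod int CARD('m)) :: 'k) = of_int z"
proof -
  have "int CHAR('k) dvd z mod int CARD('m) - z"
    using even_card char_k by (metis dvd_trans mod_eq_dvd_iff mod_mod_trivial of_nat_numeral)
  then show ?thesis by (metis eq_iff_diff_eq_0 of_int_diff of_int_eq_0_iff_char_dvd)
qed

lemma reduce_hom: "comm_ring_hom (\<lambda>x :: 'm mod_ring. of_int (to_int_mod_ring x) :: 'k)"
proof unfold_locales
  fix x y :: "'m mod_ring"
  have "to_int_mod_ring (x + y) = (to_int_mod_ring x + to_int_mod_ring y) mod int CARD('m)"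
    by transfer simp
  then show "(of_int (to_int_mod_ring (x + y)) :: 'k) = of_int (to_int_mod_ring x) + of_int (to_int_mod_ring y)"
    by (simp add: of_int_mod_card)
  have "to_int_mod_ring (x * y) = (to_int_mod_ring x * to_int_mod_ring y) mod int CARD('m)"
    by transfer simp
  then show "(of_int (to_int_mod_ring (x * y)) :: 'k) = of_int (to_int_mod_ring x) * of_int (to_int_mod_ring y)"
    by (simp add: of_int_mod_card)
qed auto

lemma map_poly_reduce_hom:
  "map_poly_comm_ring_hom (\<lambda>x :: 'm mod_ring. of_int (to_int_mod_ring x) :: 'k)"
  by (intro map_poly_comm_ring_hom.intro reduce_hom)

lemma two_power_eq_0: "(2 :: 'm mod_ring) ^ r = 0"
  using of_nat_card_eq_0[where ?'a='m] by (simp add: card_m)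

text \<open>The coefficients have even representatives, and halving these gives
  \<open>t\<close>.\<close>

lemma reduce_eq_0_imp:
  assumes "reduce_poly_mod2 (p :: 'm mod_ring poly) = (0 :: 'k poly)"
  obtains t where "p = 2 * t"
proof -
  have "even (to_int_mod_ring (Polynomial.coeff p n))" for n
  proof -
    have "Polynomial.coeff (reduce_poly_mod2 p) n = (0::'k)" using assms by simp
    then have "of_int (to_int_mod_ring (Polynomial.coeff p n)) = (0::'k)"
      by (simp add: reduce_poly_mod2_def coeff_map_poly)
    then show ?thesis using char_k by (simp add: of_int_eq_0_iff_char_dvd)
  qed
  then have "Polynomial.coeff p n = 2 * of_int (to_int_mod_ring (Polynomial.coeff p n) div 2)" for n
    by (metis dvd_mult_div_cancel of_int_mod_ring_to_int_mod_ring of_int_mult of_int_numeral of_int_of_int_mod_ring)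
  then have "p = Polynomial.smult 2 (map_poly (\<lambda>x. of_int (to_int_mod_ring x div 2)) p)"
    by (intro poly_eqI) (simp add: coeff_map_poly)
  also have "\<dots> = 2 * map_poly (\<lambda>x. of_int (to_int_mod_ring x div 2)) p"
    by (simp add: numeral_poly)
  finally show ?thesis by (rule that)
qed

text \<open>The divisor on the left need not be monic, so the division is carried out by a monic
  polynomial with the same reduction.\<close>

lemma reduce_dvd_imp:
  fixes A B :: "'m mod_ring poly"
  assumes "lead_coeff (reduce_poly_mod2 A :: 'k poly) = 1"
    and "(reduce_poly_mod2 A :: 'k poly) dvd reduce_poly_mod2 B"
  obtains Q T where "B = A * Q + 2 * T"
proof -
  interpret \<phi>: map_poly_comm_ring_hom "\<lambda>x :: 'm mod_ring. of_int (to_int_mod_ring x) :: 'k"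
    by (rule map_poly_reduce_hom)
  let ?\<phi> = "reduce_poly_mod2 :: 'm mod_ring poly \<Rightarrow> 'k poly"
  define d where "d = Polynomial.degree (?\<phi> A)"
  \<comment> \<open>\<open>M\<close> keeps the coefficients of \<open>A\<close> below
    \<open>d\<close> and puts 1 at \<open>d\<close>; the coefficients of \<open>A\<close> above
    \<open>d\<close> reduce to 0.\<close>
  define M where "M = (\<Sum>i<d. Polynomial.monom (Polynomial.coeff A i) i) + Polynomial.monom 1 d"
  have coeff_M: "Polynomial.coeff M n = (if n < d then Polynomial.coeff A n else if n = d then 1 else 0)" for n
    by (simp add: M_def coeff_sum coeff_monom sum.If_cases)
  have deg_M: "Polynomial.degree M = d"
    by (intro antisym degree_le le_degree) (auto simp: coeff_M)
  have monic_M: "lead_coeff M = 1" by (simp add: deg_M coeff_M)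
  have "?\<phi> M = ?\<phi> A"
  proof (rule poly_eqI)
    fix n
    have "Polynomial.coeff (?\<phi> A) n = (if n = d then 1 else 0)" if "n \<ge> d"
      using that assms(1) by (auto simp: d_def coeff_eq_0)
    then show "Polynomial.coeff (?\<phi> M) n = Polynomial.coeff (?\<phi> A) n"
      by (auto simp: reduce_poly_mod2_def coeff_map_poly coeff_M)
  qed
  obtain Q S where QS: "B = M * Q + S" "S = 0 \<or> Polynomial.degree S < Polynomial.degree M"
    using monic_M by (rule monic_division)
  have "?\<phi> B = ?\<phi> M * ?\<phi> Q + ?\<phi> S"
    by (simp only: QS(1) reduce_poly_mod2_def \<phi>.hom_mult \<phi>.hom_add)
  then have dvd: "?\<phi> A dvd ?\<phi> S"
    using assms(2) \<open>?\<phi> M = ?\<phi> A\<close> by (metis dvd_add_right_iff dvd_triv_left)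
  \<comment> \<open>The reduced remainder has degree below \<open>d\<close> or is 0, yet it is
    divisible by a polynomial of degree \<open>d\<close>.\<close>
  have "?\<phi> S = 0"
  proof (rule ccontr)
    assume "?\<phi> S \<noteq> 0"
    then have "S \<noteq> 0" by (auto simp: reduce_poly_mod2_def)
    have "d \<le> Polynomial.degree (?\<phi> S)"
      using dvd_imp_degree_le[OF dvd \<open>?\<phi> S \<noteq> 0\<close>] by (simp add: d_def)
    also have "\<dots> \<le> Polynomial.degree S"
      unfolding reduce_poly_mod2_def by (rule degree_map_poly_le)
    finally show False using QS(2) \<open>S \<noteq> 0\<close> deg_M by simp
  qed
  have "?\<phi> (B - A * Q) = ?\<phi> M * ?\<phi> Q + ?\<phi> S - ?\<phi> A * ?\<phi> Q"
    by (simp only: QS(1) reduce_poly_mod2_def \<phi>.hom_mult \<phi>.hom_add \<phi>.hom_minus)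
  then have "?\<phi> (B - A * Q) = 0" using \<open>?\<phi> S = 0\<close> \<open>?\<phi> M = ?\<phi> A\<close> by simp
  then obtain T where "B - A * Q = 2 * T" by (rule reduce_eq_0_imp)
  then show ?thesis by (intro that[of Q T]) (simp add: algebra_simps)
qed

end

lemma unit_1_minus_nilpotent:
  fixes x :: "'a::comm_ring_1"
  assumes "x ^ n = 0"
  shows "1 - x dvd 1"
proof -
  have "x ^ n - 1 = (x - 1) * (\<Sum>i<n. x ^ i)" by (rule power_diff_1_eq)
  then have "1 = (1 - x) * (\<Sum>i<n. x ^ i)" using assms by (simp add: algebra_simps)
  then show ?thesis by (rule dvdI)
qed

section \<open>The ideal generated by the lifted factor\<close>

text \<open>With \<open>a\<close> the even root modulo \<open>2 ^ r\<close>, the sign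
  \<open>e = -1\<close> gives E and \<open>e = 1\<close> gives E'.\<close>

definition qr_gen :: "nat \<Rightarrow> int \<Rightarrow> int \<Rightarrow> 'm::nontriv mod_ring poly" where
  "qr_gen l a e = [:of_int (1 - a):] + chi_poly l e"

context
  fixes l r :: nat and a :: int and \<zeta> :: "'k::field"
    and F_plus F_minus :: "'m::nontriv mod_ring poly"
  assumes l: "prime l" "[l = 7] (mod 8)"
    and m: "r \<ge> 1" "CARD('m) = 2 ^ r"
    and \<zeta>: "CHAR('k) = 2" "primitive_root_of_one l \<zeta>"
    and coeff_minus: "Polynomial.coeff (f_minus l \<zeta>) ((l - 3) div 2) = 1"
    and lifts: "lifts_qr_factors l \<zeta> F_plus F_minus"
    and a: "even a" "2 ^ r dvd a\<^sup>2 - a + int ((l + 1) div 4)"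
begin

lemma l_mod_4: "[l = 3] (mod 4)"
proof -
  have "[l = 7] (mod 4)" by (rule cong_dvd_modulus_nat[OF l(2)]) simp
  then show ?thesis by (simp add: cong_def)
qed

lemma l_gt_2: "2 < l"
  using l(2) mod_less_eq_dividend[of l 8] by (simp add: cong_def)

lemma poly_chi_poly_root: "poly (chi_poly l e) \<zeta> = (\<Sum>j | j < l \<and> Legendre (int j) (int l) = e. \<zeta> ^ j)"
proof -
  have "poly (chi_poly l e) \<zeta> = (\<Sum>j<l. if Legendre (int j) (int l) = e then \<zeta> ^ j else 0)"
    unfolding poly_per_poly by (rule sum.cong) auto
  also have "\<dots> = (\<Sum>j | j < l \<and> Legendre (int j) (int l) = e. \<zeta> ^ j)"
    by (simp add: sum.If_cases Collect_conj_eq lessThan_def)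
  finally show ?thesis .
qed

lemma minus_one_eq_one: "(- 1 :: 'k) = 1"
proof -
  have "of_nat CHAR('k) = (0::'k)" by (rule of_nat_CHAR)
  then have "(1::'k) + 1 = 0" by (simp add: \<zeta>(1))
  then show ?thesis by (rule minus_unique)
qed

text \<open>As \<open>f_minus\<close> has degree \<open>(l - 1) div 2\<close>, the normalized
  coefficient is its second highest one: minus the sum of the \<open>\<zeta> ^ j\<close> over the
  nonresidues. The sign disappears in characteristic 2.\<close>

lemma poly_nonresidues_root: "poly (chi_poly l (-1)) \<zeta> = 1"
proof -
  let ?S = "{j. j < l \<and> Legendre (int j) (int l) = - 1}"
  have card: "card ?S = (l - 1) div 2" using card_Legendre[OF l(1) l_mod_4] by simp
  have "card ?S - 1 = (l - 3) div 2" "card ?S \<noteq> 0" using l_gt_2 by (auto simp: card)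
  moreover from this(2) have "?S \<noteq> {}" by force
  ultimately have "- (\<Sum>j\<in>?S. \<zeta> ^ j) = 1"
    using coeff_prod_linear[of ?S "\<lambda>j. \<zeta> ^ j"] coeff_minus[unfolded f_minus_def] by simp
  then have "(\<Sum>j\<in>?S. \<zeta> ^ j) = - 1" by (metis minus_minus)
  then show ?thesis unfolding poly_chi_poly_root minus_one_eq_one .
qed

text \<open>At \<open>\<zeta> ^ j\<close> with \<open>j\<close> of symbol \<open>e\<close>, the sign
  \<open>- e\<close> becomes \<open>e * - e = -1\<close>, so the value is that of the nonresidue sum
  at \<open>\<zeta>\<close>, namely 1, and 1 + 1 = 0. The roots are distinct because
  \<open>\<zeta>\<close> is primitive.\<close>

lemma linear_factors_dvd_chi_poly:
  assumes "e = 1 \<or> e = -1"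
  shows "(\<Prod>j | j < l \<and> Legendre (int j) (int l) = e. [:- (\<zeta> ^ j), 1:]) dvd 1 + chi_poly l (- e)"
proof (rule prod_linear_dvd)
  show "inj_on (\<lambda>j. \<zeta> ^ j) {j. j < l \<and> Legendre (int j) (int l) = e}"
    by (rule inj_on_subset[OF primitive_root_inj[OF \<zeta>(2)]]) auto
next
  fix j assume "j \<in> {j. j < l \<and> Legendre (int j) (int l) = e}"
  then have j: "Legendre (int j) (int l) = e" by simp
  have "poly (chi_poly l (- e)) (\<zeta> ^ j) = poly (chi_poly l (e * - e)) \<zeta>"
    using poly_chi_poly_power[OF l(1) l_gt_2, of \<zeta> j "- e"] \<zeta>(2) assms j
    by (auto simp: primitive_root_of_one_def)
  also have "e * - e = -1" using assms by auto
  finally show "poly (1 + chi_poly l (- e)) (\<zeta> ^ j) = 0"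
    using poly_nonresidues_root minus_one_eq_one by (simp add: add_eq_0_iff)
qed simp

lemma reduce_qr_gen: "reduce_poly_mod2 (qr_gen l a e :: 'm mod_ring poly) = (1 + chi_poly l e :: 'k poly)"
proof -
  interpret h: comm_ring_hom "\<lambda>x :: 'm mod_ring. of_int (to_int_mod_ring x) :: 'k"
    using m(2,1) \<zeta>(1) by (rule reduce_hom)
  have "(of_int (to_int_mod_ring (of_int z :: 'm mod_ring)) :: 'k) = of_int z" for z
    by (rule h.hom_of_int)
  moreover have "(of_int (1 - a) :: 'k) = 1"
    using a(1) \<zeta>(1) by (simp add: of_int_eq_0_iff_char_dvd)
  moreover have "(of_int (to_int_mod_ring (of_bool b :: 'm mod_ring)) :: 'k) = of_bool b" for b
    by (cases b) auto
  ultimately show ?thesis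
    unfolding reduce_poly_mod2_def qr_gen_def
    by (intro poly_eqI)
      (auto simp: coeff_map_poly coeff_per_poly h.hom_add coeff_pCons split: nat.splits simp del: of_int_diff)
qed

text \<open>Both sides times the monic polynomial \<open>X - 1\<close> give
  \<open>X^l - 1\<close>.\<close>

lemma F_plus_F_minus: "F_plus * F_minus = per_poly l (\<lambda>_. 1)"
proof -
  have "[:- 1, 1:] * (F_plus * F_minus) = [:- 1, 1:] * per_poly l (\<lambda>_. 1)"
    using lifts by (simp only: lifts_qr_factors_def per_poly_one_mult mult.assoc)
  then have "[:- 1, 1:] * (F_plus * F_minus - per_poly l (\<lambda>_. 1)) = 0"
    by (simp only: right_diff_distrib) simp
  then show ?thesis
    by (subst (asm) monic_mult_eq_0_iff) auto
qed

text \<open>The divisibilities modulo 2 are lifted at the price of an even error term. The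
  reductions of \<open>F_plus\<close> and \<open>F_minus\<close> are monic, which is all that the
  lifting asks.\<close>

lemma qr_gen_lift:
  obtains Q T Q' T' where "qr_gen l a (-1) = F_plus * Q + 2 * T" and "qr_gen l a 1 = F_minus * Q' + 2 * T'"
proof -
  have red: "reduce_poly_mod2 F_plus = f_plus l \<zeta>" "reduce_poly_mod2 F_minus = f_minus l \<zeta>"
    using lifts by (auto simp: lifts_qr_factors_def)
  have "f_plus l \<zeta> dvd reduce_poly_mod2 (qr_gen l a (-1) :: 'm mod_ring poly)"
    using linear_factors_dvd_chi_poly[of 1] by (simp add: reduce_qr_gen f_plus_def)
  moreover have "lead_coeff (f_plus l \<zeta>) = 1"
    unfolding f_plus_def by (rule degree_lead_coeff_prod_linear[THEN conjunct2])
  ultimately obtain Q T where 1: "qr_gen l a (-1) = F_plus * Q + 2 * T"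
    using reduce_dvd_imp[OF m(2,1) \<zeta>(1), of F_plus "qr_gen l a (-1)", unfolded red] by blast
  have "f_minus l \<zeta> dvd reduce_poly_mod2 (qr_gen l a 1 :: 'm mod_ring poly)"
    using linear_factors_dvd_chi_poly[of "-1"] by (simp add: reduce_qr_gen f_minus_def)
  moreover have "lead_coeff (f_minus l \<zeta>) = 1"
    unfolding f_minus_def by (rule degree_lead_coeff_prod_linear[THEN conjunct2])
  ultimately obtain Q' T' where 2: "qr_gen l a 1 = F_minus * Q' + 2 * T'"
    using reduce_dvd_imp[OF m(2,1) \<zeta>(1), of F_minus "qr_gen l a 1", unfolded red] by blast
  from 1 2 show ?thesis by (rule that)
qed

lemma qr_gen_sum:
  obtains s where "qr_gen l a (-1) + qr_gen l a 1 = 1 - 2 * s + F_plus * F_minus"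
proof -
  have J: "F_plus * F_minus = 1 + chi_poly l 1 + chi_poly l (-1)"
    unfolding F_plus_F_minus by (rule chi_poly_sum[symmetric]) (use l_gt_2 in simp)
  define s :: "'m mod_ring poly" where "s = [:of_int a:]"
  have A: "[:of_int (1 - a) :: 'm mod_ring:] = 1 - s"
    by (simp add: s_def one_pCons)
  have "qr_gen l a (-1) + qr_gen l a 1 = 1 - 2 * s + F_plus * F_minus"
    unfolding qr_gen_def A J by (simp add: algebra_simps)
  then show ?thesis by (rule that)
qed

lemma qr_gen_mult:
  "Polynomial.monom 1 l - 1 dvd (qr_gen l a (-1) :: 'm mod_ring poly) * qr_gen l a 1 -
    Polynomial.smult (of_int (int ((l + 1) div 4) - a)) (per_poly l (\<lambda>_. 1))"
proof -
  define J N R :: "'m mod_ring poly"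
    where "J = per_poly l (\<lambda>_. 1)" and "N = chi_poly l (-1)" and "R = chi_poly l 1"
  define n where "n = (l + 1) div 4"
  define s t :: "'m mod_ring poly" where "s = [:of_int a:]" and "t = [:of_nat n:]"
  have "int CARD('m) dvd a\<^sup>2 - a + int n" using a(2) m(2) by (simp add: n_def)
  then have "of_int (a\<^sup>2 - a + int n) = (0 :: 'm mod_ring)"
    by (elim dvdE) (simp only: of_int_mult of_int_of_nat_eq of_nat_card_eq_0 mult_zero_left)
  then have "[:of_int (a\<^sup>2 - a + int n) :: 'm mod_ring:] = 0" by simp
  then have zero: "s * s - s + t = 0" by (simp add: s_def t_def power2_eq_square)
  have J: "J = 1 + R + N"
    unfolding J_def R_def N_def by (rule chi_poly_sum[symmetric]) (use l_gt_2 in simp)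
  have A: "[:of_int (1 - a) :: 'm mod_ring:] = 1 - s"
    by (simp add: s_def one_pCons)
  have smult: "Polynomial.smult (of_int (int n - a)) J = (t - s) * J"
    "Polynomial.smult (of_nat n - 1) J = (t - 1) * J"
    by (simp_all add: s_def t_def one_pCons)
  \<comment> \<open>Here \<open>N + R = J - 1\<close> is used to expand the product;
    \<open>s * s - s + t\<close> vanishes by the choice of \<open>a\<close>, and the second bracket
    is a multiple of \<open>X^l - 1\<close>.\<close>
  have "(qr_gen l a (-1) :: 'm mod_ring poly) * qr_gen l a 1 - (t - s) * J = (s * s - s + t) + (N * R - (t + (t - 1) * J))"
    unfolding qr_gen_def A N_def[symmetric] R_def[symmetric] J by (simp add: algebra_simps)
  then have "qr_gen l a (-1) * qr_gen l a 1 - Polynomial.smult (of_int (int n - a)) J =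
      N * R - (t + Polynomial.smult (of_nat n - 1) J)"
    by (simp only: zero smult add_0)
  then show ?thesis
    using chi_poly_mult[OF l(1) l_mod_4, where ?'a = "'m mod_ring"]
    by (simp only: J_def N_def R_def n_def t_def)
qed

lemma monom_minus_1_factor: "Polynomial.monom 1 l - 1 = F_plus * ([:- 1, 1:] * F_minus)"
  using lifts by (simp only: lifts_qr_factors_def mult.left_commute[of F_plus] mult.assoc)

lemma one_minus_even_unit: "1 - 2 * (t :: 'm mod_ring poly) dvd 1"
proof (rule unit_1_minus_nilpotent)
  have "(2 :: 'm mod_ring poly) ^ r = [:2 ^ r:]"
    by (simp add: numeral_poly poly_const_pow)
  also have "\<dots> = 0" using two_power_eq_0[OF m(2,1) \<zeta>(1)] by simp
  finally show "(2 * t) ^ r = 0" by (simp only: power_mult_distrib mult_zero_left)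
qed

text \<open>\<open>F_plus\<close> divides \<open>X^l - 1\<close> and the all-one polynomial, hence
  the product E E'. Modulo \<open>F_plus\<close> the factor E' is 1 minus an even polynomial, a
  unit, so \<open>F_plus\<close> divides E.\<close>

lemma F_plus_dvd_qr_gen: "F_plus dvd qr_gen l a (-1)"
proof -
  obtain Q T where Q: "qr_gen l a (-1) = F_plus * Q + 2 * T" using qr_gen_lift by blast
  obtain s where "qr_gen l a (-1) + qr_gen l a 1 = 1 - 2 * s + F_plus * F_minus" by (rule qr_gen_sum)
  then have unit: "qr_gen l a 1 + F_plus * (Q - F_minus) = 1 - 2 * (s + T)"
    by (simp add: Q algebra_simps)
  obtain u where u: "1 = (1 - 2 * (s + T)) * u" by (rule dvdE[OF one_minus_even_unit])
  have "F_plus dvd qr_gen l a (-1) * qr_gen l a 1 -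
      Polynomial.smult (of_int (int ((l + 1) div 4) - a)) (per_poly l (\<lambda>_. 1))"
    using qr_gen_mult unfolding monom_minus_1_factor by (rule dvd_mult_left)
  moreover have "F_plus dvd Polynomial.smult c (per_poly l (\<lambda>_. 1))" for c
    by (rule dvd_smult) (simp flip: F_plus_F_minus)
  ultimately have "F_plus dvd qr_gen l a (-1) * qr_gen l a 1"
    by (metis dvd_add diff_add_cancel)
  moreover have "F_plus dvd F_plus * (Q - F_minus) * qr_gen l a (-1)"
    by (simp only: mult.assoc dvd_triv_left)
  ultimately have "F_plus dvd (qr_gen l a (-1) * qr_gen l a 1 + F_plus * (Q - F_minus) * qr_gen l a (-1)) * u"
    by (rule dvd_mult2[OF dvd_add])
  also have "\<dots> = qr_gen l a (-1) * ((qr_gen l a 1 + F_plus * (Q - F_minus)) * u)"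
    by (simp only: algebra_simps)
  also have "\<dots> = qr_gen l a (-1)" by (simp only: unit u[symmetric] mult_1_right)
  finally show ?thesis .
qed

text \<open>Some combination of E and \<open>F_minus\<close> is a unit. Multiplying it by
  \<open>F_plus\<close> turns \<open>F_minus\<close> into the all-one polynomial.\<close>

lemma F_plus_combination:
  obtains A B where "F_plus = A * qr_gen l a (-1) + B * per_poly l (\<lambda>_. 1)"
proof -
  obtain Q T where Q: "qr_gen l a 1 = F_minus * Q + 2 * T" using qr_gen_lift by blast
  obtain s where "qr_gen l a (-1) + qr_gen l a 1 = 1 - 2 * s + F_plus * F_minus" by (rule qr_gen_sum)
  then have unit: "qr_gen l a (-1) + F_minus * (Q - F_plus) = 1 - 2 * (s + T)"
    by (simp add: Q algebra_simps)
  obtain u where u: "1 = (1 - 2 * (s + T)) * u" by (rule dvdE[OF one_minus_even_unit])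
  have "F_plus = F_plus * ((qr_gen l a (-1) + F_minus * (Q - F_plus)) * u)"
    by (simp only: unit u[symmetric] mult_1_right)
  also have "\<dots> = (F_plus * u) * qr_gen l a (-1) + ((Q - F_plus) * u) * (F_plus * F_minus)"
    by (simp only: algebra_simps)
  finally show ?thesis unfolding F_plus_F_minus by (rule that)
qed

end

section \<open>Powers of the prime ideal above 2 and their action\<close>

definition omega :: "nat \<Rightarrow> complex" where
  "omega l = (1 - sqrt_minus l) / 2"

definition quad_elem :: "nat \<Rightarrow> int \<Rightarrow> int \<Rightarrow> complex" where
  "quad_elem l p q = of_int p + of_int q * omega l"

lemma conj_omega: "(1 + sqrt_minus l) / 2 = 1 - omega l"
  by (simp add: omega_def field_simps)

lemma omega_square:
  assumes "4 * m = int l + 1"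
  shows "omega l * omega l = omega l - of_int m"
proof -
  have "complex_of_real (sqrt (real l)) * complex_of_real (sqrt (real l)) = of_nat l"
    by (metis of_real_mult of_real_of_nat_eq of_nat_0_le_iff real_sqrt_mult_self abs_of_nonneg)
  moreover have "sqrt_minus l * sqrt_minus l =
      (\<i> * \<i>) * (complex_of_real (sqrt (real l)) * complex_of_real (sqrt (real l)))"
    by (simp only: sqrt_minus_def ac_simps)
  moreover have "of_nat l = (4 * of_int m - 1 :: complex)"
    using arg_cong[OF assms, of "of_int :: int \<Rightarrow> complex"] by (simp add: algebra_simps)
  ultimately have square: "sqrt_minus l * sqrt_minus l = 1 - 4 * of_int m"
    by simp
  have "omega l * omega l = (1 - 2 * sqrt_minus l + sqrt_minus l * sqrt_minus l) / 4"
    by (simp add: omega_def field_simps)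
  also have "\<dots> = omega l - of_int m"
    unfolding square by (simp add: omega_def field_simps)
  finally show ?thesis .
qed

lemma quad_elem_add: "quad_elem l p q + quad_elem l p' q' = quad_elem l (p + p') (q + q')"
  and quad_elem_diff: "quad_elem l p q - quad_elem l p' q' = quad_elem l (p - p') (q - q')"
  and quad_elem_of_int: "quad_elem l p 0 = of_int p"
  by (simp_all add: quad_elem_def algebra_simps)

lemma quad_elem_mult:
  assumes "4 * m = int l + 1"
  shows "quad_elem l p q * quad_elem l p' q' = quad_elem l (p * p' - m * q * q') (p * q' + p' * q + q * q')"
proof -
  have "quad_elem l p q * quad_elem l p' q' = of_int p * of_int p' + (of_int p * of_int q' + of_int p' * of_int q) * omega l
      + of_int q * of_int q' * (omega l * omega l)"
    by (simp add: quad_elem_def algebra_simps)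
  then show ?thesis unfolding omega_square[OF assms] by (simp add: quad_elem_def algebra_simps)
qed

lemma quad_elem_in_quad_order: "quad_elem l p q \<in> quad_order l"
proof -
  have "quad_elem l p q = poly (map_poly of_int [:p + q, - q:]) ((1 + sqrt_minus l) / 2)"
    unfolding conj_omega by (simp add: quad_elem_def algebra_simps of_int_hom.map_poly_pCons_hom)
  then show ?thesis unfolding quad_order_def by (rule range_eqI)
qed

text \<open>Horner's scheme: multiplication by the generator \<open>1 - omega l\<close> and addition
  of an integer keep integral coordinates with respect to 1 and \<open>omega l\<close>.\<close>

lemma quad_order_quad_elem:
  assumes "4 * m = int l + 1" "z \<in> quad_order l"
  obtains p q where "z = quad_elem l p q"
proof -
  have "\<exists>p q. poly (map_poly of_int P) ((1 + sqrt_minus l) / 2) = quad_elem l p q" for P :: "int poly"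
  proof (induction P)
    case 0
    show ?case by (intro exI[of _ 0]) (simp add: quad_elem_def)
  next
    case (pCons c P)
    then obtain p q where pq: "poly (map_poly of_int P) ((1 + sqrt_minus l) / 2) = quad_elem l p q" by blast
    have "poly (map_poly of_int (pCons c P)) ((1 + sqrt_minus l) / 2) =
        quad_elem l c 0 + quad_elem l 1 (-1) * quad_elem l p q"
      unfolding pq[symmetric] conj_omega by (simp add: quad_elem_def algebra_simps of_int_hom.map_poly_pCons_hom)
    then show ?case by (auto simp: quad_elem_add quad_elem_mult[OF assms(1)])
  qed
  then show ?thesis using assms(2) that unfolding quad_order_def by blast
qed

text \<open>As \<open>a\<close> and \<open>m\<close> are even, substituting \<open>a\<close> for
  \<open>omega l\<close> is multiplicative modulo 2, and it sends both generators to even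
  numbers.\<close>

lemma Q_ideal_quad_elem:
  assumes "4 * m = int l + 1" "even m" "even a" "z \<in> Q_ideal l"
  shows "\<exists>p q. z = quad_elem l p q \<and> 2 dvd p + q * a"
proof -
  have gens: "{2, (1 - sqrt_minus l) / 2} = {quad_elem l 2 0, quad_elem l 0 1}"
    by (simp add: quad_elem_def omega_def)
  show ?thesis using assms(4) unfolding Q_ideal_def ideal_generated_def gens
  proof (induction rule: group_closure.induct)
    case (base s)
    have *: "\<exists>p q. \<alpha> * g = quad_elem l p q \<and> 2 dvd p + q * a"
      if \<alpha>: "\<alpha> \<in> quad_order l" and g: "g = quad_elem l 2 0 \<or> g = quad_elem l 0 1" for \<alpha> g
    proof -
      obtain p q where pq: "\<alpha> = quad_elem l p q" by (rule quad_order_quad_elem[OF assms(1) \<alpha>])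
      have "\<alpha> * quad_elem l 2 0 = quad_elem l (2 * p) (2 * q)" "\<alpha> * quad_elem l 0 1 = quad_elem l (- (m * q)) (p + q)"
        by (simp_all add: pq quad_elem_mult[OF assms(1)] mult.commute)
      moreover have "2 dvd 2 * p + 2 * q * a" "2 dvd - (m * q) + (p + q) * a"
        using assms(2,3) by auto
      ultimately show ?thesis using g by blast
    qed
    from base show ?case
    proof
      \<comment> \<open>\<open>group_closure\<close> adjoins 0 to its generators.\<close>
      assume "s = 0"
      then show ?case using quad_elem_of_int[of l 0] by (intro exI[of _ 0]) simp
    qed (use * in blast)
  next
    case (diff s t)
    then obtain p q p' q' where "s = quad_elem l p q" "2 dvd p + q * a" "t = quad_elem l p' q'" "2 dvd p' + q' * a"
      by blast
    moreover have "p - p' + (q - q') * a = (p + q * a) - (p' + q' * a)" by (simp add: algebra_simps)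
    ultimately show ?case by (metis quad_elem_diff dvd_diff)
  qed
qed

text \<open>Each factor from \<open>Q_ideal\<close> contributes one factor 2 to
  \<open>p + q * a\<close>. The bound \<open>k \<le> r\<close> is there because \<open>a\<close> is
  a root only modulo \<open>2 ^ r\<close>.\<close>

lemma Q_power_quad_elem:
  assumes "4 * m = int l + 1" "even m" "even a" "2 ^ r dvd a\<^sup>2 - a + m"
  shows "k \<le> r \<Longrightarrow> z \<in> Q_power l k \<Longrightarrow> \<exists>p q. z = quad_elem l p q \<and> 2 ^ k dvd p + q * a"
proof (induction k arbitrary: z)
  case 0
  obtain p q where "z = quad_elem l p q"
    using 0 by (auto elim: quad_order_quad_elem[OF assms(1)])
  then show ?case by auto
next
  case (Suc k)
  from Suc.prems(2)[unfolded Q_power.simps ideal_times_def] show ?case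
  proof (induction rule: group_closure.induct)
    case (base s)
    show ?case
    proof (cases "s = 0")
      case True
      then show ?thesis using quad_elem_of_int[of l 0] by (intro exI[of _ 0]) simp
    next
      case False
      then obtain \<alpha> \<beta> where s: "s = \<alpha> * \<beta>" "\<alpha> \<in> Q_ideal l" "\<beta> \<in> Q_power l k" using base by blast
      obtain p q where pq: "\<alpha> = quad_elem l p q" "2 dvd p + q * a"
        using Q_ideal_quad_elem[OF assms(1-3) s(2)] by blast
      obtain p' q' where pq': "\<beta> = quad_elem l p' q'" "2 ^ k dvd p' + q' * a"
        using Suc.IH[OF _ s(3)] Suc.prems(1) by auto
      \<comment> \<open>\<open>p + q \<omega> \<mapsto> p + q a\<close> is multiplicative modulo \<open>2 ^ r\<close>.\<close>
      have "(p * p' - m * q * q') + (p * q' + p' * q + q * q') * a =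
          (p + q * a) * (p' + q' * a) - q * q' * (a\<^sup>2 - a + m)"
        by (simp add: power2_eq_square algebra_simps)
      moreover have "2 ^ Suc k dvd (p + q * a) * (p' + q' * a)"
        using mult_dvd_mono[OF pq(2) pq'(2)] by simp
      moreover have "2 ^ Suc k dvd q * q' * (a\<^sup>2 - a + m)"
        using assms(4) Suc.prems(1) by (meson dvd_mult dvd_trans le_imp_power_dvd)
      ultimately show ?thesis using s pq pq' quad_elem_mult[OF assms(1)] by (metis dvd_diff)
    qed
  next
    case (diff s t)
    then obtain p q p' q' where "s = quad_elem l p q" "2 ^ Suc k dvd p + q * a"
      "t = quad_elem l p' q'" "2 ^ Suc k dvd p' + q' * a"
      by blast
    moreover have "p - p' + (q - q') * a = (p + q * a) - (p' + q' * a)" by (simp add: algebra_simps)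
    ultimately show ?case by (metis quad_elem_diff dvd_diff)
  qed
qed

lemma group_closure_of_int_mult:
  fixes z :: complex
  assumes "z \<in> group_closure S"
  shows "of_int n * z \<in> group_closure S"
proof (cases n rule: int_cases2)
  case (nonneg k)
  then show ?thesis using group_closure_scalar_mult_left[OF assms, of k] by simp
next
  case (nonpos k)
  then show ?thesis using group_closure_scalar_mult_left[OF assms, of k]
    by (simp add: group_closure_minus_iff)
qed

text \<open>The converse direction: \<open>omega l - a\<close> and \<open>2 ^ r\<close> lie in the
  power of the ideal, so they suffice to produce all codewords later.\<close>

lemma quad_elem_in_Q_power:
  assumes "4 * m = int l + 1"
  shows "even a \<Longrightarrow> 2 ^ r dvd a\<^sup>2 - a + m \<Longrightarrow> quad_elem l (- a) 1 \<in> Q_power l r \<and> quad_elem l (2 ^ r) 0 \<in> Q_power l r"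
proof (induction r)
  case 0
  show ?case by (simp add: quad_elem_in_quad_order)
next
  case (Suc r)
  obtain n where n: "a\<^sup>2 - a + m = 2 ^ Suc r * n" using Suc.prems(2) by (elim dvdE)
  then have "2 ^ r dvd a\<^sup>2 - a + m" by simp
  then have IH: "quad_elem l (- a) 1 \<in> Q_power l r" "quad_elem l (2 ^ r) 0 \<in> Q_power l r"
    using Suc.IH Suc.prems(1) by auto
  have gen: "x * y \<in> Q_power l (Suc r)" if "x \<in> Q_ideal l" "y \<in> Q_power l r" for x y
    using that unfolding Q_power.simps ideal_times_def by (intro group_closure.base) blast
  have Q: "quad_elem l 2 0 \<in> Q_ideal l" "quad_elem l 0 1 \<in> Q_ideal l"
  proof -
    have "quad_elem l 1 0 * 2 \<in> Q_ideal l" "quad_elem l 1 0 * ((1 - sqrt_minus l) / 2) \<in> Q_ideal l"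
      unfolding Q_ideal_def ideal_generated_def using quad_elem_in_quad_order
      by (blast intro: group_closure.base)+
    then show "quad_elem l 2 0 \<in> Q_ideal l" "quad_elem l 0 1 \<in> Q_ideal l" by (simp_all add: quad_elem_def omega_def)
  qed
  have two_r: "quad_elem l (2 ^ Suc r) 0 \<in> Q_power l (Suc r)"
    using gen[OF Q(1) IH(2)] by (simp add: quad_elem_mult[OF assms])
  have 1: "quad_elem l (- 2 * a) 2 \<in> Q_power l (Suc r)"
    using gen[OF Q(1) IH(1)] by (simp add: quad_elem_mult[OF assms])
  have 2: "quad_elem l (- m) (1 - a) \<in> Q_power l (Suc r)"
    using gen[OF Q(2) IH(1)] by (simp add: quad_elem_mult[OF assms])
  obtain b where b: "a = 2 * b" using Suc.prems(1) by (elim evenE)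
  \<comment> \<open>The sum of \<omega> (\<omega> - a) and a (\<omega> - a) is \<omega> - a minus
    \<open>a\<^sup>2 - a + m\<close>. Evenness of \<open>a\<close> exhibits the second summand as
    \<open>b\<close> times 2 (\<omega> - a).\<close>
  have "quad_elem l (- a) 1 = quad_elem l (- m) (1 - a) + of_int b * quad_elem l (- 2 * a) 2 + of_int n * quad_elem l (2 ^ Suc r) 0"
  proof -
    have m: "m = 2 ^ Suc r * n - a\<^sup>2 + a" using n by simp
    show ?thesis unfolding m b quad_elem_def by (simp add: algebra_simps power2_eq_square)
  qed
  also have "\<dots> \<in> Q_power l (Suc r)"
    using 1 2 two_r unfolding Q_power.simps ideal_times_def
    by (intro group_closure_add group_closure_of_int_mult)
  finally show ?case using two_r by blast
qed

section \<open>The action of the order in coordinates\<close>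

lemma sum_mod_ring: "(\<Sum>j\<in>UNIV. g (to_int_mod_ring (j :: 'l::finite mod_ring))) = (\<Sum>i<CARD('l). g (int i))"
proof -
  have "(\<Sum>j\<in>UNIV. g (to_int_mod_ring (j :: 'l mod_ring))) = sum g (range (to_int_mod_ring :: 'l mod_ring \<Rightarrow> int))"
    by (rule sum.reindex_cong[symmetric, of to_int_mod_ring])
      (auto simp: inj_on_def dest: arg_cong[of _ _ of_int_mod_ring])
  also have "\<dots> = (\<Sum>i<CARD('l). g (int i))"
    unfolding range_to_int_mod_ring 
    by (rule sum.reindex_cong[of int]) (auto simp: image_int_atLeastLessThan lessThan_atLeast0 inj_on_def)
  finally show ?thesis .
qed

lemma sum_option: "(\<Sum>\<mu>\<in>UNIV. f \<mu>) = f None + (\<Sum>j\<in>UNIV. f (Some (j :: 'b::finite)))"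
  by (simp add: UNIV_option_conv sum.reindex)

text \<open>\<open>omega l\<close> acts as half of the identity minus the Paley matrix.\<close>

lemma act_quad_elem:
  "act (quad_elem CARD('l) p q) v $ \<nu> =
    (of_int p + of_int q / 2) * v $ \<nu> - of_int q / 2 * (\<Sum>\<mu>\<in>UNIV. v $ \<mu> * paley $ \<mu> $ (\<nu> :: 'l::finite coord))"
proof -
  have "CARD('l) > 0" by simp
  then have "sqrt (real CARD('l)) \<noteq> 0" by simp
  then have Re: "Re (quad_elem CARD('l) p q) = of_int p + of_int q / 2"
    and Im: "Im (quad_elem CARD('l) p q) / sqrt (real CARD('l)) = - of_int q / 2"
    by (simp_all add: quad_elem_def omega_def sqrt_minus_def)
  have mat: "(\<Sum>\<mu>\<in>UNIV. v $ \<mu> * mat 1 $ \<mu> $ \<nu>) = v $ \<nu>"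
    by (simp add: mat_def if_distrib[of "(*) _"] cong: if_cong)
  have act: "act z v $ \<nu> = Re z * (\<Sum>\<mu>\<in>UNIV. v $ \<mu> * mat 1 $ \<mu> $ \<nu>) +
      Im z / sqrt (real CARD('l)) * (\<Sum>\<mu>\<in>UNIV. v $ \<mu> * paley $ \<mu> $ \<nu>)" for z
    unfolding act_def vector_matrix_mult_def sum_distrib_left sum.distrib[symmetric]
    by simp (rule sum.cong; simp add: algebra_simps)
  show ?thesis unfolding act mat Re Im by simp
qed

lemma act_add: "act z (u + v) = act z u + act z v"
  unfolding act_def vec_eq_iff vector_matrix_mult_def
  by (simp only: vec_lambda_beta vector_add_component distrib_left distrib_right sum.distrib simp_thms) simp

text \<open>Write \<open>p + q * omega l\<close> as \<open>(p + q * a) + q * (omega l - a)\<close>;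
  with \<open>N = 2 ^ r\<close> the first part vanishes on integer vectors after reduction.\<close>

lemma act_quad_elem_reduce:
  assumes "p + q * a = N * t"
  shows "act (quad_elem CARD('l) p q) v = of_int (N * t) *\<^sub>R v + of_int q *\<^sub>R act (quad_elem CARD('l) (- a) 1) (v :: real ^ 'l::finite coord)"
proof -
  have p: "p = N * t - q * a" using assms by simp
  show ?thesis unfolding p by (simp add: vec_eq_iff act_quad_elem algebra_simps)
qed

lemma paley_simps [simp]:
  "paley $ None $ None = 0" "paley $ None $ Some j = 1" "paley $ Some i $ None = -1"
  "paley $ Some i $ Some j =
    of_int (Legendre (to_int_mod_ring j - to_int_mod_ring i) (int CARD('l)))" for i j :: "'l::finite mod_ring"
  by (simp_all add: paley_def)

text \<open>Integral coefficients of E. On the finite coordinates they are the entries of the matrix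
  of \<open>omega l - a\<close> with 1/2 added to each, as functions of the index
  difference.\<close>

definition qr_kernel :: "nat \<Rightarrow> int \<Rightarrow> int \<Rightarrow> int" where
  "qr_kernel l a y = (if int l dvd y then 1 - a else 0) + of_bool (Legendre y (int l) = -1)"

lemma qr_kernel_mod: "qr_kernel l a (y mod int l) = qr_kernel l a y"
  by (simp add: qr_kernel_def dvd_mod_iff)

lemma to_int_mod_ring_dvd_diff_iff:
  "int CARD('l) dvd to_int_mod_ring j - to_int_mod_ring i \<longleftrightarrow> i = (j :: 'l::finite mod_ring)"
proof
  assume dvd: "int CARD('l) dvd to_int_mod_ring j - to_int_mod_ring i"
  have "to_int_mod_ring j \<in> {0..<int CARD('l)}" "to_int_mod_ring i \<in> {0..<int CARD('l)}"
    unfolding range_to_int_mod_ring[symmetric] by auto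
  then have "to_int_mod_ring j = to_int_mod_ring i"
    using dvd by (simp add: mod_eq_dvd_iff[symmetric])
  then show "i = j" by (metis of_int_mod_ring_to_int_mod_ring)
qed simp

text \<open>Eliminating the infinite coordinate by means of the coordinate sum \<open>2 * k\<close>
  replaces the half-integral matrix by the integral kernel and leaves the constant
  \<open>- k\<close>.\<close>

lemma act_L_zero:
  fixes v :: "real ^ 'l::finite coord"
  assumes x: "\<And>\<mu>. v $ \<mu> = of_int (x \<mu>)" and sum: "(\<Sum>\<mu>\<in>UNIV. x \<mu>) = 2 * k"
  shows "act (quad_elem CARD('l) (- a) 1) v $ None = of_int (k - a * x None)"
    and "act (quad_elem CARD('l) (- a) 1) v $ Some j = of_int
      ((\<Sum>i\<in>UNIV. x (Some i) * qr_kernel CARD('l) a (to_int_mod_ring j - to_int_mod_ring i)) - k)"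
proof -
  let ?c = "\<lambda>i. Legendre (to_int_mod_ring j - to_int_mod_ring i) (int CARD('l))"
  have sum': "(\<Sum>i\<in>UNIV. x (Some i)) = 2 * k - x None"
    using sum by (simp add: sum_option)
  then have real_sum: "(\<Sum>i\<in>UNIV. real_of_int (x (Some i))) = 2 * of_int k - of_int (x None)"
    by (simp flip: of_int_sum)
  show "act (quad_elem CARD('l) (- a) 1) v $ None = of_int (k - a * x None)"
    unfolding act_quad_elem by (simp add: sum_option x sum_negf real_sum field_simps)
  have kernel: "2 * qr_kernel CARD('l) a (to_int_mod_ring j - to_int_mod_ring i) =
      (if i = j then 1 - 2 * a else 0) + 1 - ?c i" for i
    unfolding qr_kernel_def to_int_mod_ring_dvd_diff_iff
    using Legendre_cases[of "to_int_mod_ring j - to_int_mod_ring i" "int CARD('l)"]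
      Legendre_eq_0_iff[of "to_int_mod_ring j - to_int_mod_ring i" "int CARD('l)",
        unfolded to_int_mod_ring_dvd_diff_iff]
    by (elim disjE) simp_all
  have "2 * (\<Sum>i\<in>UNIV. x (Some i) * qr_kernel CARD('l) a (to_int_mod_ring j - to_int_mod_ring i)) =
      (\<Sum>i\<in>UNIV. x (Some i) * (2 * qr_kernel CARD('l) a (to_int_mod_ring j - to_int_mod_ring i)))"
    by (simp add: sum_distrib_left ac_simps)
  also have "\<dots> = (\<Sum>i\<in>UNIV. x (Some i) * (if i = j then 1 - 2 * a else 0)) +
      (\<Sum>i\<in>UNIV. x (Some i)) - (\<Sum>i\<in>UNIV. x (Some i) * ?c i)"
    unfolding kernel by (simp add: algebra_simps sum.distrib sum_subtractf)
  also have "\<dots> = (1 - 2 * a) * x (Some j) + (2 * k - x None) - (\<Sum>i\<in>UNIV. x (Some i) * ?c i)"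
    unfolding sum' by (simp add: if_distrib[of "(*) _"] cong: if_cong)
  finally have "real_of_int (2 * (\<Sum>i\<in>UNIV. x (Some i) * qr_kernel CARD('l) a (to_int_mod_ring j - to_int_mod_ring i))) =
      of_int ((1 - 2 * a) * x (Some j) + (2 * k - x None) - (\<Sum>i\<in>UNIV. x (Some i) * ?c i))"
    by (rule arg_cong)
  then show "act (quad_elem CARD('l) (- a) 1) v $ Some j = of_int
      ((\<Sum>i\<in>UNIV. x (Some i) * qr_kernel CARD('l) a (to_int_mod_ring j - to_int_mod_ring i)) - k)"
    unfolding act_quad_elem by (simp add: sum_option x field_simps)
qed

lemma sum_Legendre_shift:
  assumes "prime CARD('l::finite)" "[CARD('l) = 3] (mod 4)"
  shows "(\<Sum>i\<in>UNIV. Legendre (to_int_mod_ring j - to_int_mod_ring (i :: 'l mod_ring)) (int CARD('l))) = 0"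
proof -
  have "(\<Sum>i\<in>UNIV. Legendre (to_int_mod_ring j - to_int_mod_ring (i :: 'l mod_ring)) (int CARD('l))) =
      (\<Sum>i<CARD('l). Legendre (-1 * int i + to_int_mod_ring j) (int CARD('l)))"
    using sum_mod_ring[of "\<lambda>y. Legendre (to_int_mod_ring j - y) (int CARD('l))", where ?'l='l]
    by (simp add: algebra_simps)
  also have "\<dots> = 0"
    by (subst sum_periodic_affine) (auto simp: sum_Legendre[OF assms])
  finally show ?thesis .
qed

text \<open>The extra generator of \<open>L_plus\<close> has all coordinates 1/2, so its images are
  governed by the column sums of the Paley matrix: \<open>- l\<close> at infinity and 1 elsewhere.
  Integrality uses that \<open>a\<close> is even.\<close>

lemma half_vector:
  assumes "prime CARD('l::finite)" "[CARD('l) = 3] (mod 4)" "4 * m = int CARD('l) + 1" "even a"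
  defines "h \<equiv> (1 / 2) *\<^sub>R (axis None 1 v* (mat 1 + paley)) :: real ^ 'l coord"
  shows "h $ \<mu> = 1 / 2"
    and "act (quad_elem CARD('l) (- a) 1) h $ None = of_int (m - a div 2)"
    and "act (quad_elem CARD('l) (- a) 1) h $ Some j = of_int (- (a div 2))"
proof -
  show h: "h $ \<mu> = 1 / 2" for \<mu>
    by (cases \<mu>) (simp_all add: h_def vector_matrix_mult_def sum_option axis_def mat_def)
  obtain b where b: "a = 2 * b" using assms(4) by (elim evenE)
  have "real CARD('l) = 4 * of_int m - 1"
    using arg_cong[OF assms(3), of real_of_int] by simp
  then show "act (quad_elem CARD('l) (- a) 1) h $ None = of_int (m - a div 2)"
    unfolding act_quad_elem by (simp add: h sum_option b field_simps)
  have "(\<Sum>i\<in>UNIV. real_of_int (Legendre (to_int_mod_ring j - to_int_mod_ring (i :: 'l mod_ring)) (int CARD('l)))) = 0"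
    using sum_Legendre_shift[OF assms(1,2), of j] by (simp flip: of_int_sum)
  then show "act (quad_elem CARD('l) (- a) 1) h $ Some j = of_int (- (a div 2))"
    unfolding act_quad_elem by (simp add: h sum_option b field_simps flip: sum_distrib_left sum_divide_distrib)
qed

section \<open>Vectors as polynomials, and the code as an ideal\<close>

lemma vec_poly_per_poly:
  fixes c :: "('m::nontriv mod_ring) ^ 'l::finite mod_ring"
  assumes "\<And>j. c $ j = f (to_int_mod_ring j)"
  shows "vec_poly c = per_poly CARD('l) f"
  unfolding vec_poly_def per_poly_def assms
  using sum_mod_ring[of "\<lambda>y. Polynomial.monom (f y) (nat y)", where ?'l='l] by simp

lemma vec_poly_inj:
  fixes c d :: "('m::nontriv mod_ring) ^ 'l::finite mod_ring"
  assumes "vec_poly c = vec_poly d"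
  shows "c = d"
proof -
  have "Polynomial.coeff (vec_poly c) (nat (to_int_mod_ring j)) = c $ j" for c :: "'m mod_ring ^ 'l mod_ring" and j
  proof -
    have "to_int_mod_ring j \<in> {0..<int CARD('l)}" unfolding range_to_int_mod_ring[symmetric] by auto
    then show ?thesis
      using vec_poly_per_poly[of c "\<lambda>y. c $ of_int_mod_ring y"] by (simp add: coeff_per_poly nat_less_iff)
  qed
  then show ?thesis using assms by (metis vec_eq_iff)
qed

text \<open>Since \<open>g\<close> divides the modulus, the ideal of the quotient pulls back to the
  multiples of \<open>g\<close>.\<close>

lemma cyclic_code_iff_dvd:
  fixes c :: "('m::nontriv mod_ring) ^ 'l::finite mod_ring"
  assumes "g dvd Polynomial.monom 1 CARD('l) - 1"
  shows "c \<in> cyclic_code g \<longleftrightarrow> g dvd vec_poly c"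
proof
  assume "c \<in> cyclic_code g"
  then obtain q where "Polynomial.monom 1 CARD('l) - 1 dvd vec_poly c - q * g"
    unfolding cyclic_code_def by blast
  then have "g dvd (vec_poly c - q * g) + q * g"
    using assms by (intro dvd_add) (auto intro: dvd_trans)
  then show "g dvd vec_poly c" by simp
next
  assume "g dvd vec_poly c"
  then obtain q where "vec_poly c = q * g" by (metis dvdE mult.commute)
  then have "Polynomial.monom 1 CARD('l) - 1 dvd vec_poly c - q * g" by simp
  then show "c \<in> cyclic_code g" unfolding cyclic_code_def by blast
qed

lemma coeff_vec_poly_eq_0:
  "i \<ge> CARD('l) \<Longrightarrow> Polynomial.coeff (vec_poly (c :: ('m::nontriv mod_ring) ^ 'l::finite mod_ring)) i = 0"
  using vec_poly_per_poly[of c "\<lambda>y. c $ of_int_mod_ring y"] by (simp add: coeff_per_poly)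

definition code_poly :: "real ^ 'l::finite coord \<Rightarrow> 'm::nontriv mod_ring poly" where
  "code_poly u = vec_poly (delete_infinity (reduce_vec u))"

lemma code_poly_eq:
  assumes "\<And>j. u $ Some j = of_int (f (to_int_mod_ring j))"
  shows "code_poly (u :: real ^ 'l::finite coord) = per_poly CARD('l) (\<lambda>y. of_int (f y))"
  unfolding code_poly_def
  by (rule vec_poly_per_poly) (simp add: delete_infinity_def reduce_vec_def assms)

lemma integer_vectorsE:
  assumes "u \<in> integer_vectors"
  obtains x :: "_ \<Rightarrow> int" where "\<And>\<mu>. u $ \<mu> = of_int (x \<mu>)"
  using assms that[of "\<lambda>\<mu>. \<lfloor>u $ \<mu>\<rfloor>"] unfolding integer_vectors_def by simp

lemma integer_vectors_combination:
  assumes "u \<in> integer_vectors" "v \<in> integer_vectors"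
  shows "of_int s *\<^sub>R u + of_int t *\<^sub>R v \<in> integer_vectors"
  using assms unfolding integer_vectors_def by simp

text \<open>Integrality is essential: \<open>reduce_vec\<close> takes floors, which are additive on
  integers only.\<close>

lemma code_poly_combination:
  fixes u v :: "real ^ 'l::finite coord"
  assumes "u \<in> integer_vectors" "v \<in> integer_vectors"
  shows "(code_poly (of_int s *\<^sub>R u + of_int t *\<^sub>R v) :: 'm::nontriv mod_ring poly) =
    Polynomial.smult (of_int s) (code_poly u) + Polynomial.smult (of_int t) (code_poly v)"
proof -
  obtain x where x: "\<And>\<mu>. u $ \<mu> = of_int (x \<mu>)" using integer_vectorsE[OF assms(1)] by blast
  obtain y where y: "\<And>\<mu>. v $ \<mu> = of_int (y \<mu>)" using integer_vectorsE[OF assms(2)] by blast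
  have "code_poly u = (per_poly CARD('l) (\<lambda>z. of_int (x (Some (of_int_mod_ring z)))) :: 'm mod_ring poly)"
    by (rule code_poly_eq) (simp add: x)
  moreover have "code_poly v = (per_poly CARD('l) (\<lambda>z. of_int (y (Some (of_int_mod_ring z)))) :: 'm mod_ring poly)"
    by (rule code_poly_eq) (simp add: y)
  moreover have "code_poly (of_int s *\<^sub>R u + of_int t *\<^sub>R v) = (per_poly CARD('l)
      (\<lambda>z. of_int (s * x (Some (of_int_mod_ring z)) + t * y (Some (of_int_mod_ring z)))) :: 'm mod_ring poly)"
    by (rule code_poly_eq) (simp add: x y)
  ultimately show ?thesis by (simp add: smult_per_poly per_poly_add)
qed

lemma per_poly_qr_kernel:
  "CARD('l::finite) = l \<Longrightarrow> per_poly l (\<lambda>y. of_int (qr_kernel l a y)) = (qr_gen l a (-1) :: 'm::nontriv mod_ring poly)"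
proof -
  assume "CARD('l) = l"
  then have "l > 0" by force
  have "(\<lambda>y. of_int (qr_kernel l a y)) = (\<lambda>y. (if int l dvd y then of_int (1 - a) else 0) +
      (of_bool (Legendre y (int l) = -1) :: 'm mod_ring))"
    by (auto simp: qr_kernel_def fun_eq_iff)
  then show ?thesis unfolding qr_gen_def
    by (simp only: per_poly_add[symmetric] per_poly_delta[OF \<open>l > 0\<close>])
qed

text \<open>The finite part of \<open>act_L_zero\<close> is a cyclic convolution with the kernel,
  that is, multiplication by E modulo \<open>X^l - 1\<close>.\<close>

lemma code_poly_act:
  fixes v :: "real ^ 'l::finite coord"
  assumes x: "\<And>\<mu>. v $ \<mu> = of_int (x \<mu>)" and sum: "(\<Sum>\<mu>\<in>UNIV. x \<mu>) = 2 * k"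
  shows "Polynomial.monom 1 CARD('l) - 1 dvd
    per_poly CARD('l) (\<lambda>y. of_int (x (Some (of_int_mod_ring y)))) * qr_gen CARD('l) a (-1) -
      Polynomial.smult (of_int k) (per_poly CARD('l) (\<lambda>_. 1)) -
    (code_poly (act (quad_elem CARD('l) (- a) 1) v) :: 'm::nontriv mod_ring poly)"
proof -
  define xi where "xi y = x (Some (of_int_mod_ring y))" for y
  define h where "h y = (\<Sum>i<CARD('l). xi (int i) * qr_kernel CARD('l) a (y - int i)) - k" for y
  have "act (quad_elem CARD('l) (- a) 1) v $ Some j = of_int (h (to_int_mod_ring j))" for j
    using sum_mod_ring[of "\<lambda>i. xi i * qr_kernel CARD('l) a (to_int_mod_ring j - i)", where ?'l='l]
    unfolding act_L_zero(2)[OF x sum] h_def by (simp add: xi_def)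
  then have "code_poly (act (quad_elem CARD('l) (- a) 1) v) = (per_poly CARD('l) (\<lambda>y. of_int (h y)) :: 'm mod_ring poly)"
    by (rule code_poly_eq)
  also have "\<dots> = per_poly CARD('l) (\<lambda>y. \<Sum>i<CARD('l). of_int (xi (int i)) * of_int (qr_kernel CARD('l) a (y - int i))) -
      Polynomial.smult (of_int k) (per_poly CARD('l) (\<lambda>_. 1))"
    by (rule poly_eqI) (simp add: coeff_per_poly h_def)
  finally show ?thesis
    using per_poly_mult_cong[of "\<lambda>y. of_int (qr_kernel CARD('l) a y) :: 'm mod_ring" "CARD('l)" "\<lambda>y. of_int (xi y)"]
    unfolding per_poly_qr_kernel[OF refl] by (simp add: qr_kernel_mod xi_def)
qed

text \<open>The first conjunct ensures that the floor in \<open>reduce_vec\<close> acts on integers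
  only, so that the second speaks of genuine reduction.\<close>

theorem theorem4p3:
  fixes l r :: nat
    and \<zeta> :: "'k::finite_field"
    and F_plus F_minus :: "'m::nontriv mod_ring poly"
  assumes "prime l" and "[l = 7] (mod 8)" and "CARD('l::finite) = l"
    and "r \<ge> 1" and "CARD('m) = 2 ^ r"
    and "CHAR('k) = 2" and "primitive_root_of_one l \<zeta>"
    and "Polynomial.coeff (f_plus l \<zeta>) ((l - 3) div 2) = 0"
    and "Polynomial.coeff (f_minus l \<zeta>) ((l - 3) div 2) = 1"
    and "lifts_qr_factors l \<zeta> F_plus F_minus"
  shows "(Q_power_L_plus r :: (real ^ ('l coord)) set) \<subseteq> integer_vectors \<and>
    delete_infinity ` (reduced_code r :: (('m mod_ring) ^ ('l coord)) set) = cyclic_code F_plus"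
proof -
  define m where "m = (l + 1) div 4"
  have "l mod 8 = 7" using assms(2) by (simp add: cong_def)
  then have l: "l = 8 * (l div 8) + 7" using div_mult_mod_eq[of l 8] by simp
  then have m4: "4 * int m = int l + 1" and even_m: "even (int m)" and l0: "l > 0"
    unfolding m_def by presburger+
  have l4: "[l = 3] (mod 4)" using cong_dvd_modulus_nat[OF assms(2), of 4] by (simp add: cong_def)
  obtain a where a: "even a" "2 ^ r dvd a\<^sup>2 - a + int m"
    using even_quadratic_root_mod_two_power[OF even_m assms(4)] by blast
  note ctx = assms(1,2,4,5,6,7,9,10) a[unfolded m_def]
  let ?J = "per_poly l (\<lambda>_. 1) :: 'm mod_ring poly"
  let ?U = "Polynomial.monom 1 l - 1 :: 'm mod_ring poly"
  let ?E = "qr_gen l a (-1) :: 'm mod_ring poly"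
  have F_U: "F_plus dvd ?U" using monom_minus_1_factor[OF ctx] by simp
  have F_J: "F_plus dvd ?J" using F_plus_F_minus[OF ctx] by (metis dvd_triv_left)
  have F_E: "F_plus dvd ?E" by (rule F_plus_dvd_qr_gen[OF ctx])
  have two_r: "(of_int (2 ^ r * t) :: 'm mod_ring) = 0" for t
    using two_power_eq_0[OF assms(5,4,6)] by simp
  let ?act = "\<lambda>v :: real ^ 'l coord. act (quad_elem l (- a) 1) v"
  \<comment> \<open>This property is stable under integer combinations, so checking it on generators
    yields both integrality and one inclusion of codes.\<close>
  define good where "good u \<longleftrightarrow> u \<in> integer_vectors \<and> F_plus dvd code_poly u" for u :: "real ^ 'l coord"
  have good_combination: "good (of_int s *\<^sub>R u + of_int t *\<^sub>R v)" if "good u" "good v" for s t u v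
    using that unfolding good_def
    by (simp add: integer_vectors_combination code_poly_combination dvd_add dvd_smult)
  have good_act: "good (?act v)" if x: "\<And>\<mu>. v $ \<mu> = of_int (x \<mu>)" and sum: "(\<Sum>\<mu>\<in>UNIV. x \<mu>) = 2 * k" for v x k
  proof -
    have "?act v $ \<mu> \<in> \<int>" for \<mu>
      using act_L_zero[OF x sum, of a] by (cases \<mu>) (simp_all only: assms(3) Ints_of_int)
    moreover have "F_plus dvd code_poly (?act v)"
    proof -
      define Y where "Y = per_poly l (\<lambda>y. of_int (x (Some (of_int_mod_ring y)))) * ?E -
        Polynomial.smult (of_int k) ?J"
      have "F_plus dvd Y"
        unfolding Y_def using F_E F_J by (intro dvd_diff dvd_mult dvd_smult)
      moreover have "F_plus dvd Y - code_poly (?act v)"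
        using code_poly_act[OF x sum, of a, where ?'m='m] dvd_trans[OF F_U] by (simp add: assms(3) Y_def)
      ultimately have "F_plus dvd Y - (Y - code_poly (?act v))" by (rule dvd_diff)
      then show ?thesis by simp
    qed
    ultimately show ?thesis by (simp add: good_def integer_vectors_def)
  qed
  have good_L_zero: "good (act (quad_elem l p q) v)" if v0: "v \<in> L_zero" and pq: "2 ^ r dvd p + q * a" for p q and v :: "real ^ 'l coord"
  proof -
    obtain t where t: "p + q * a = 2 ^ r * t" by (rule dvdE[OF pq])
    have v: "v \<in> integer_vectors" using v0 unfolding L_zero_def by blast
    obtain x where x: "\<And>\<mu>. v $ \<mu> = of_int (x \<mu>)" using integer_vectorsE[OF v] by blast
    obtain k :: int where "(\<Sum>\<mu>\<in>UNIV. v $ \<mu>) = 2 * of_int k"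
      using v0 unfolding L_zero_def by blast
    then have "of_int (\<Sum>\<mu>\<in>UNIV. x \<mu>) = (of_int (2 * k) :: real)" by (simp add: x)
    then have sum: "(\<Sum>\<mu>\<in>UNIV. x \<mu>) = 2 * k" by (simp only: of_int_eq_iff)
    have "good (?act v)" by (rule good_act[OF x sum])
    then show ?thesis
      using v act_quad_elem_reduce[OF t, of v] unfolding good_def assms(3)
      by (simp only: integer_vectors_combination code_poly_combination two_r)
        (simp add: dvd_smult)
  qed
  have good_L_plus: "good (act (quad_elem l p q) v)" if vL: "v \<in> L_plus" and pq: "2 ^ r dvd p + q * a" for p q and v :: "real ^ 'l coord"
  proof (cases "v \<in> L_zero")
    case False
    define h :: "real ^ 'l coord" where "h = (1 / 2) *\<^sub>R (axis None 1 v* (mat 1 + paley))"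
    obtain w where w: "w \<in> L_zero" "v = h + w"
      using vL False unfolding L_plus_def h_def by blast
    obtain t where t: "p + q * a = 2 ^ r * t" by (rule dvdE[OF pq])
    \<comment> \<open>The vector \<open>h\<close> is only half-integral; because
      \<open>r \<ge> 1\<close>, the multiple by \<open>2 ^ r * t\<close> is integral, though it need
      not vanish modulo \<open>2 ^ r\<close>.\<close>
    have half: "of_int (2 ^ r * t) * (1 / 2 :: real) = of_int (2 ^ (r - 1) * t)"
      using assms(4) by (cases r) simp_all
    note hv = half_vector[where ?'l='l, unfolded assms(3), OF assms(1) l4 m4 a(1), folded h_def]
    have None: "act (quad_elem l p q) h $ None = of_int (2 ^ (r - 1) * t + q * (int m - a div 2))"
      and Some: "act (quad_elem l p q) h $ Some j = of_int (2 ^ (r - 1) * t - q * (a div 2))" for j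
      using act_quad_elem_reduce[OF t, of h] half by (simp_all add: assms(3) hv)
    \<comment> \<open>The image of \<open>h\<close> is constant on the finite coordinates, so it
      contributes a multiple of the all-one polynomial, which \<open>F_plus\<close> divides.\<close>
    have "code_poly (act (quad_elem l p q) h) = Polynomial.smult (of_int (2 ^ (r - 1) * t - q * (a div 2))) ?J"
      using code_poly_eq[of "act (quad_elem l p q) h" "\<lambda>_. 2 ^ (r - 1) * t - q * (a div 2)"] Some
      by (simp add: assms(3) smult_per_poly)
    moreover have "act (quad_elem l p q) h $ \<mu> \<in> \<int>" for \<mu>
      using None Some by (cases \<mu>) (simp_all only: Ints_of_int)
    ultimately have "good (act (quad_elem l p q) h)"
      using F_J by (simp add: good_def integer_vectors_def dvd_smult)
    then have "good (of_int 1 *\<^sub>R act (quad_elem l p q) h + of_int 1 *\<^sub>R act (quad_elem l p q) w)"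
      by (rule good_combination) (rule good_L_zero[OF w(1) pq])
    then show ?thesis unfolding w(2) act_add by simp
  qed (rule good_L_zero[OF _ pq])
  have good: "good u" if "u \<in> Q_power_L_plus r" for u :: "real ^ 'l coord"
    using that unfolding Q_power_L_plus_def
  proof (induction rule: group_closure.induct)
    case (base s)
    have "good 0"
      using good_act[of 0 "\<lambda>_. 0" 0] good_combination[of "?act 0" "?act 0" 0 0] by simp
    moreover have "good (act \<alpha> v)" if "\<alpha> \<in> Q_power l r" "v \<in> L_plus" for \<alpha> v
      using Q_power_quad_elem[OF m4 even_m a order_refl that(1)] good_L_plus[OF that(2)] by blast
    ultimately show ?case using base by (auto simp: assms(3))
  next
    case (diff s t)
    then show ?case using good_combination[of s t 1 "-1"] by simp
  qed
  have "delete_infinity ` reduced_code r \<subseteq> (cyclic_code F_plus :: ('m mod_ring ^ 'l mod_ring) set)"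
  proof
    fix c :: "'m mod_ring ^ 'l mod_ring" assume "c \<in> delete_infinity ` reduced_code r"
    then obtain u where "u \<in> Q_power_L_plus r" "c = delete_infinity (reduce_vec (u :: real ^ 'l coord))"
      unfolding reduced_code_def by blast
    then show "c \<in> cyclic_code F_plus"
      using good[of u] F_U by (simp add: cyclic_code_iff_dvd assms(3) good_def code_poly_def)
  qed
  moreover have "(cyclic_code F_plus :: ('m mod_ring ^ 'l mod_ring) set) \<subseteq> delete_infinity ` reduced_code r"
  proof
    fix c :: "'m mod_ring ^ 'l mod_ring" assume "c \<in> cyclic_code F_plus"
    then obtain q where q: "vec_poly c = F_plus * q"
      using F_U by (auto simp: cyclic_code_iff_dvd assms(3))
    obtain A B where AB: "F_plus = A * ?E + B * ?J" by (rule F_plus_combination[OF ctx])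
    \<comment> \<open>The codeword is \<open>A * q\<close> times E plus \<open>B * q\<close> times
      the all-one polynomial. Modulo \<open>X^l - 1\<close> the first multiplier may be reduced to
      degree below \<open>l\<close>, the second to its value at 1.\<close>
    obtain \<alpha> where \<alpha>: "?U dvd A * q - per_poly l \<alpha>" using exists_per_poly_cong[OF l0] by blast
    define \<beta> where "\<beta> = poly (B * q) 1"
    \<comment> \<open>The sign compensates the subtraction of \<open>k\<close> times the all-one
      polynomial in \<open>code_poly_act\<close>.\<close>
    define k where "k = - to_int_mod_ring \<beta>"
    \<comment> \<open>The finite coordinates lift \<alpha>. The deleted coordinate is free, and is
      chosen to make the integer sum exactly \<open>2 * k\<close>, which puts the vector in
      \<open>L_zero\<close>.\<close>
    define x :: "'l coord \<Rightarrow> int" where "x \<mu> = (case \<mu> of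
        None \<Rightarrow> 2 * k - (\<Sum>i\<in>UNIV. to_int_mod_ring (\<alpha> (to_int_mod_ring (i :: 'l mod_ring))))
      | Some i \<Rightarrow> to_int_mod_ring (\<alpha> (to_int_mod_ring i)))" for \<mu>
    define v :: "real ^ 'l coord" where "v = (\<chi> \<mu>. of_int (x \<mu>))"
    have x: "v $ \<mu> = of_int (x \<mu>)" for \<mu> by (simp add: v_def)
    have sum: "(\<Sum>\<mu>\<in>UNIV. x \<mu>) = 2 * k" by (simp add: sum_option x_def)
    have "v \<in> L_zero"
    proof -
      have "(\<Sum>\<mu>\<in>UNIV. v $ \<mu>) = of_int (2 * k)" unfolding x sum[symmetric] by simp
      then show ?thesis unfolding L_zero_def integer_vectors_def by (auto simp: x)
    qed
    then have mem: "?act v \<in> Q_power_L_plus r"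
      unfolding Q_power_L_plus_def using quad_elem_in_Q_power[OF m4 a] assms(3)
      by (intro group_closure.base) (auto simp: L_plus_def)
    have of_int_to_int: "of_int (to_int_mod_ring z) = z" for z :: "'m mod_ring"
      by (simp add: of_int_of_int_mod_ring)
    have "per_poly l (\<lambda>y. of_int (x (Some (of_int_mod_ring y)))) = per_poly l \<alpha>"
      by (rule per_poly_cong) (simp add: x_def of_int_to_int assms(3))
    then have "?U dvd (per_poly l \<alpha> * ?E + Polynomial.smult \<beta> ?J) - code_poly (?act v)"
      using code_poly_act[OF x sum, of a, where ?'m='m] by (simp add: assms(3) k_def of_int_to_int)
    moreover have "?U dvd (A * q - per_poly l \<alpha>) * ?E + (B * q * ?J - Polynomial.smult \<beta> ?J)"
      unfolding \<beta>_def by (intro dvd_add dvd_mult2 \<alpha> per_poly_one_absorb)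
    ultimately have "?U dvd ((per_poly l \<alpha> * ?E + Polynomial.smult \<beta> ?J) - code_poly (?act v)) +
        ((A * q - per_poly l \<alpha>) * ?E + (B * q * ?J - Polynomial.smult \<beta> ?J))"
      by (rule dvd_add)
    also have "\<dots> = (A * ?E + B * ?J) * q - code_poly (?act v)" by (simp add: algebra_simps)
    also have "\<dots> = vec_poly c - code_poly (?act v)" by (simp only: AB[symmetric] q)
    \<comment> \<open>Both polynomials have degree below \<open>l\<close>, so their congruence is an
      equality.\<close>
    finally have "vec_poly c - code_poly (?act v) = 0"
      by (rule monom_minus_1_dvd_imp_0[OF _ _ l0])
        (simp add: code_poly_def coeff_vec_poly_eq_0 assms(3))
    then have "c = delete_infinity (reduce_vec (?act v))"
      by (intro vec_poly_inj) (simp add: code_poly_def)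
    then show "c \<in> delete_infinity ` reduced_code r"
      using mem unfolding reduced_code_def by blast
  qed
  ultimately show ?thesis using good by (auto simp: good_def)
qed

end
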